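(* Let $a_\dagger>0$ and $T>0$ be fixed, and let $d=d(x,s)$ and $B=B(x,s)$ be non-negative. Assume that $d$, $B$, $\psi_1$, $\psi_2$ are sufficiently smooth such that the solution $u$ to the problem (P) given in the context is thrice continuously differentiable with bounded derivatives. Moreover, assume that there exists $L>0$ such that for every $0\le x\le a_\dagger$ and $s_1,s_2>0$, $$|d(x,s_1)-d(x,s_2)|\le L|s_1-s_2|\quad\text{and}\quad |B(x,s_1)-B(x,s_2)|\le L|s_1-s_2|.$$ Let $\Phi_h$, $\boldsymbol u_h$, $\boldsymbol u^0$, $\boldsymbol U^0$, $\|\cdot\|$, $\|\cdot\|_{Y_h}$ be as in the context. Then the local discretization error $\Phi_h(\boldsymbol u_h)$ satisfies $$\|\Phi_h(\boldsymbol u_h)\|_{Y_h}=\left\{\|\boldsymbol U^0-\boldsymbol u^0\|^2+\mathcal O(h^2)+\mathcal O(k^2)\right\}^{1/2}\quad\text{as } h\to0.$$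
   Context: Problem (P), for the unknown $u(x,t)$, with given functions $d(x,s)$, $B(x,s)$, $\psi_1(x)$, $\psi_2(x)$, $u_0(x)$: $$\begin{aligned}&u_t(x,t)+u_x(x,t)+d(x,s_1(t))\,u(x,t)=u_{xx}(x,t),\quad x\in(0,a_\dagger),\ t>0,\\ &u(0,t)-u_x(0,t)=\int_0^{a_\dagger}B(x,s_2(t))\,u(x,t)\,dx,\quad t\ge0,\\ &u(a_\dagger,t)=0,\quad t\ge0,\\ &u(x,0)=u_0(x),\quad x\in(0,a_\dagger),\\ &s_i(t)=\int_0^{a_\dagger}\psi_i(x)u(x,t)\,dx,\quad t\ge0,\ i=1,2.\end{aligned}$$ Grid. $h,k>0$ are the spatial and temporal step sizes, with $a_\dagger=Mh$, $M=2(M'+3)$ for some $M'\in\mathbb N$, and $T=Nk$ for some $N\in\mathbb N$. Put $x_i=ih$, $t_n=nk$. Notation. For $\boldsymbol V=(V_1,\dots,V_{M-1})$ and $\boldsymbol W=(W_1,\dots,W_{M-1})$ in $\mathbb R^{M-1}$, $\boldsymbol V\cdot\boldsymbol W=(V_1W_1,\dots,V_{M-1}W_{M-1})$ is the componentwise product, and $$\mathcal Q_h(\boldsymbol V)=\tfrac{4h}{3}(2V_1-V_2+2V_3)+\tfrac h3\sum_{i=2}^{M'}(V_{2i}+4V_{2i+1}+V_{2i+2})+\tfrac{4h}{3}(2V_{2M'+3}-V_{2M'+4}+2V_{2M'+5}).$$ For $j=1,2$, $\boldsymbol\Psi_j=(\psi_j(x_1),\dots,\psi_j(x_{M-1}))$;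 $d_i(s)=d(x_i,s)$ and $\boldsymbol B(s)=(B(x_1,s),\dots,B(x_{M-1},s))$. Spaces and operator. $X_h=Y_h=\mathbb R^{N+1}\times(\mathbb R^{M-1})^{N+1}\times\mathbb R^{N+1}$. An element of $X_h$ is written $(\boldsymbol V_0,\boldsymbol V^0,\dots,\boldsymbol V^N,\boldsymbol V_M)$ with $\boldsymbol V_0=(V_0^0,\dots,V_0^N)$, $\boldsymbol V^n=(V_1^n,\dots,V_{M-1}^n)$, $\boldsymbol V_M=(V_M^0,\dots,V_M^N)$; similarly for $Y_h$. $\boldsymbol U^0=(U_1^0,\dots,U_{M-1}^0)$ is the initial vector of the numerical scheme, set there to $U_i^0=u_0(x_i)$. The map $\Phi_h\colon X_h\to Y_h$ sends $(\boldsymbol V_0,\boldsymbol V^0,\dots,\boldsymbol V^N,\boldsymbol V_M)$ to $(\boldsymbol P_0,\boldsymbol P^0,\dots,\boldsymbol P^N,\boldsymbol P_M)$, where $$\begin{aligned}P_0^n&=\left(1+\tfrac1h\right)V_0^n-\tfrac1hV_1^n-\mathcal Q_h\Big(\boldsymbol B\big(\mathcal Q_h(\boldsymbol\Psi_2\cdot\boldsymbol V^n)\big)\cdot\boldsymbol V^n\Big),\quad 0\le n\le N,\\ P_M^n&=\frac{V_M^n}{h},\quad 0\le n\le N,\\ P_i^0&=V_i^0-U_i^0,\quad 1\le i\le M-1,\\ P_i^n&=\frac{V_i^n-V_i^{n-1}}{k}+\frac{V_i^{n-1}-V_{i-1}^{n-1}}{h}+d_i\big(\mathcal Q_h(\boldsymbol\Psi_1\cdot\boldsymbol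 V^{n-1})\big)V_i^{n-1}-\frac{V_{i+1}^{n-1}+V_{i-1}^{n-1}-2V_i^{n-1}}{h^2},\quad 1\le n\le N,\ 1\le i\le M-1.\end{aligned}$$ Norms. $\|\boldsymbol V\|^2=\sum_{i=1}^{M-1}h|V_i|^2$ for $\boldsymbol V\in\mathbb R^{M-1}$; $\|\boldsymbol Z\|_*^2=\sum_{n=0}^Nk|Z^n|^2$ for $\boldsymbol Z=(Z^0,\dots,Z^N)\in\mathbb R^{N+1}$; and $$\|(\boldsymbol P_0,\boldsymbol P^0,\dots,\boldsymbol P^N,\boldsymbol P_M)\|_{Y_h}=\Big(\|\boldsymbol P_0\|_*^2+\|\boldsymbol P^0\|^2+h\|\boldsymbol P_M\|_*^2+\sum_{n=1}^Nk\|\boldsymbol P^n\|^2\Big)^{1/2}.$$ Discrete representation of $u$. $\boldsymbol u_h=(\boldsymbol u_0,\boldsymbol u^0,\dots,\boldsymbol u^N,\boldsymbol u_M)\in X_h$ consists of the nodal values: $\boldsymbol u_0=(u(0,t_n))_{0\le n\le N}$, $\boldsymbol u^n=(u(x_i,t_n))_{1\le i\le M-1}$, $\boldsymbol u_M=(u(a_\dagger,t_n))_{0\le n\le N}$. (The vector $\boldsymbol u_0$ is not to be confused with the initial function $u_0$.) *)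

theory Defs
  imports "HOL-Analysis.Analysis" "HOL-Library.Landau_Symbols"
begin

subsection \<open>Smoothness classes\<close>

text \<open>
  \<open>f' b\<close> is the partial derivative of \<open>f\<close> in the direction of the basis vector \<open>b\<close>. Derivatives are
  taken relative to \<open>S\<close>, so they are one-sided at boundary points belonging to \<open>S\<close> and ordinary
  derivatives if \<open>S\<close> is open.
\<close>

primrec Ck_on :: "nat \<Rightarrow> 'a::euclidean_space set \<Rightarrow> ('a \<Rightarrow> real) \<Rightarrow> bool" where
  "Ck_on 0 S f \<longleftrightarrow> continuous_on S f"
| "Ck_on (Suc m) S f \<longleftrightarrow>
     (\<exists>f'. (\<forall>p\<in>S. (f has_derivative (\<lambda>v. \<Sum>b\<in>Basis. (v \<bullet> b) * f' b p)) (at p within S)) \<and>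
           (\<forall>b\<in>Basis. Ck_on m S (f' b)))"

text \<open>
  The same, with all partial derivatives of orders \<open>1, \<dots>, k\<close> bounded on \<open>S\<close> (the function itself need
  not be bounded).
\<close>

primrec Ck_bdd_on :: "nat \<Rightarrow> 'a::euclidean_space set \<Rightarrow> ('a \<Rightarrow> real) \<Rightarrow> bool" where
  "Ck_bdd_on 0 S f \<longleftrightarrow> continuous_on S f"
| "Ck_bdd_on (Suc m) S f \<longleftrightarrow>
     (\<exists>f'. (\<forall>p\<in>S. (f has_derivative (\<lambda>v. \<Sum>b\<in>Basis. (v \<bullet> b) * f' b p)) (at p within S)) \<and>
           (\<forall>b\<in>Basis. bounded (f' b ` S) \<and> Ck_bdd_on m S (f' b)))"

subsection \<open>The continuous problem\<close>

definition weighted_population ::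
    "real \<Rightarrow> (real \<Rightarrow> real) \<Rightarrow> (real \<Rightarrow> real \<Rightarrow> real) \<Rightarrow> real \<Rightarrow> real" where
  "weighted_population a \<psi> u t = integral {0..a} (\<lambda>x. \<psi> x * u x t)"

text \<open>
  \<open>u\<close> is a classical solution, continuous up to the boundary; \<open>ut\<close>, \<open>ux\<close>, \<open>uxx\<close> are its partial
  derivatives, and at \<open>x = 0\<close> the derivative \<open>ux\<close> is the one-sided one.
\<close>

definition solves_P ::
    "real \<Rightarrow> (real \<Rightarrow> real \<Rightarrow> real) \<Rightarrow> (real \<Rightarrow> real \<Rightarrow> real) \<Rightarrow> (real \<Rightarrow> real) \<Rightarrow> (real \<Rightarrow> real) \<Rightarrow>
     (real \<Rightarrow> real) \<Rightarrow> (real \<Rightarrow> real \<Rightarrow> real) \<Rightarrow> bool" where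
  "solves_P a d B \<psi>1 \<psi>2 u0 u \<longleftrightarrow>
     continuous_on ({0..a} \<times> {0..}) (\<lambda>(x, t). u x t) \<and>
     (\<exists>ut ux uxx.
        (\<forall>x\<in>{0<..<a}. \<forall>t>0.
           ((\<lambda>\<tau>. u x \<tau>) has_real_derivative ut x t) (at t) \<and>
           ((\<lambda>y. u y t) has_real_derivative ux x t) (at x) \<and>
           ((\<lambda>y. ux y t) has_real_derivative uxx x t) (at x) \<and>
           ut x t + ux x t + d x (weighted_population a \<psi>1 u t) * u x t = uxx x t) \<and>
        (\<forall>t\<ge>0.
           ((\<lambda>y. u y t) has_real_derivative ux 0 t) (at 0 within {0..a}) \<and>
           u 0 t - ux 0 t =
             integral {0..a} (\<lambda>x. B x (weighted_population a \<psi>2 u t) * u x t))) \<and>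
     (\<forall>t\<ge>0. u a t = 0) \<and>
     (\<forall>x\<in>{0<..<a}. u x 0 = u0 x)"

subsection \<open>Grids\<close>

text \<open>
  A grid is given by the pair \<open>(M', N)\<close>. Throughout, \<open>M = 2 (M' + 3)\<close>.
\<close>

definition space_pts :: "nat \<Rightarrow> nat" where
  "space_pts M' = 2 * (M' + 3)"

definition space_step :: "real \<Rightarrow> nat \<Rightarrow> real" where
  "space_step a M' = a / real (space_pts M')"

definition time_step :: "real \<Rightarrow> nat \<Rightarrow> real" where
  "time_step T N = T / real N"

text \<open>
  The limit \<open>h \<rightarrow> 0\<close>, that is \<open>M' \<rightarrow> \<infinity>\<close>, with no relation imposed between \<open>h\<close> and \<open>k\<close>: a property holds
  eventually iff it holds for all large \<open>M'\<close> and, uniformly, for every \<open>N \<ge> 1\<close>.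
\<close>

definition refinement :: "(nat \<times> nat) filter" where
  "refinement = sequentially \<times>\<^sub>F principal {1..}"

subsection \<open>Vectors, quadrature and the discrete operator\<close>

text \<open>
  A vector in \<open>\<real>\<^sup>M\<^sup>-\<^sup>1\<close> is a function on \<open>nat\<close> of which only the values at \<open>1, \<dots>, M - 1\<close> matter. An
  element of \<open>X\<^sub>h = Y\<^sub>h\<close> is a function \<open>V\<close> of which only the values \<open>V n i\<close> with \<open>n \<le> N\<close>, \<open>i \<le> M\<close>
  matter: \<open>\<lambda>n. V n 0\<close> and \<open>\<lambda>n. V n M\<close> are the first and last blocks in \<open>\<real>\<^sup>N\<^sup>+\<^sup>1\<close>, and \<open>V n\<close> on
  \<open>1, \<dots>, M - 1\<close> is the block of time level \<open>n\<close>.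
\<close>

type_synonym grid_fun = "nat \<Rightarrow> nat \<Rightarrow> real"

definition quad :: "real \<Rightarrow> nat \<Rightarrow> (nat \<Rightarrow> real) \<Rightarrow> real" where
  "quad h M' V =
     4 * h / 3 * (2 * V 1 - V 2 + 2 * V 3)
     + h / 3 * (\<Sum>i=2..M'. V (2 * i) + 4 * V (2 * i + 1) + V (2 * i + 2))
     + 4 * h / 3 * (2 * V (2 * M' + 3) - V (2 * M' + 4) + 2 * V (2 * M' + 5))"

definition Phi ::
    "real \<Rightarrow> real \<Rightarrow> nat \<Rightarrow> (real \<Rightarrow> real \<Rightarrow> real) \<Rightarrow> (real \<Rightarrow> real \<Rightarrow> real) \<Rightarrow>
     (real \<Rightarrow> real) \<Rightarrow> (real \<Rightarrow> real) \<Rightarrow> (nat \<Rightarrow> real) \<Rightarrow> grid_fun \<Rightarrow> grid_fun" where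
  "Phi h k M' d B \<psi>1 \<psi>2 U0 V n i =
     (let x = (\<lambda>j. real j * h);
          pop = (\<lambda>\<psi> m. quad h M' (\<lambda>j. \<psi> (x j) * V m j))
      in
        if i = 0 then
          (1 + 1 / h) * V n 0 - 1 / h * V n 1 - quad h M' (\<lambda>j. B (x j) (pop \<psi>2 n) * V n j)
        else if i = space_pts M' then V n i / h
        else if n = 0 then V 0 i - U0 i
        else
          (V n i - V (n - 1) i) / k
          + (V (n - 1) i - V (n - 1) (i - 1)) / h
          + d (x i) (pop \<psi>1 (n - 1)) * V (n - 1) i
          - (V (n - 1) (i + 1) + V (n - 1) (i - 1) - 2 * V (n - 1) i) / h\<^sup>2)"

definition nodal :: "real \<Rightarrow> real \<Rightarrow> (real \<Rightarrow> real \<Rightarrow> real) \<Rightarrow> grid_fun" where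
  "nodal h k u n i = u (real i * h) (real n * k)"

subsection \<open>Norms\<close>

definition space_norm :: "real \<Rightarrow> nat \<Rightarrow> (nat \<Rightarrow> real) \<Rightarrow> real" where
  "space_norm h M' V = sqrt (\<Sum>i=1..space_pts M' - 1. h * \<bar>V i\<bar>\<^sup>2)"

definition time_norm :: "real \<Rightarrow> nat \<Rightarrow> (nat \<Rightarrow> real) \<Rightarrow> real" where
  "time_norm k N Z = sqrt (\<Sum>n=0..N. k * \<bar>Z n\<bar>\<^sup>2)"

definition Y_norm :: "real \<Rightarrow> real \<Rightarrow> nat \<Rightarrow> nat \<Rightarrow> grid_fun \<Rightarrow> real" where
  "Y_norm h k M' N P =
     sqrt ((time_norm k N (\<lambda>n. P n 0))\<^sup>2
           + (space_norm h M' (P 0))\<^sup>2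
           + h * (time_norm k N (\<lambda>n. P n (space_pts M')))\<^sup>2
           + (\<Sum>n=1..N. k * (space_norm h M' (P n))\<^sup>2))"

end

theory Submission imports Defs
begin

text \<open>
  By Taylor expansion every difference quotient in \<open>\<Phi>\<^sub>h(u\<^sub>h)\<close> matches the corresponding derivative up to
  \<open>O(h + k)\<close>, and the quadrature rule integrates Lipschitz functions up to \<open>O(h)\<close>. All population sizes,
  discrete and continuous, stay in one compact interval, on which the coefficients are Lipschitz
  because they are \<open>C\<^sup>1\<close>. Hence every residual except the initial one is \<open>O(h + k)\<close>, uniformly on the
  grid, and the squared weighted sum \<open>E\<close> of these residuals is \<open>O(h\<^sup>2 + k\<^sup>2)\<close>. It is divided between
  the two remainders as \<open>E h\<^sup>2 / (h\<^sup>2 + k\<^sup>2)\<close> and \<open>E k\<^sup>2 / (h\<^sup>2 + k\<^sup>2)\<close>.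
\<close>

subsection \<open>Lipschitz functions\<close>

text \<open>Derivatives of \<open>u\<close> are available on the open rectangle only, whereas the
  scheme also samples \<open>u\<close> at \<open>x = 0\<close>, \<open>x = a\<close>,
  \<open>t = 0\<close> and \<open>t = T\<close>. There the proof has continuity and, at
  \<open>x = 0\<close>, a one-sided \<open>x\<close>-derivative. The Taylor estimates are therefore
  mean value arguments, whose intermediate points are interior, and weak inequalities proved for
  open times are extended to the end times by continuity. First order is all that the claim demands,
  so the quadrature formulas are exploited only through their exactness for constants. As
  \<open>h\<close> and \<open>k\<close> are unrelated and the available bound on \<open>E\<close>
  mixes them, \<open>E\<close> does not come as an \<open>h\<close>-part plus a
  \<open>k\<close>-part; this is why it is shared out in proportion to the squared steps.\<close>

lemma Ck_on_1_lipschitz_on_compact: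
  fixes f :: "'a::euclidean_space \<Rightarrow> real"
  assumes f: "Ck_on 1 S f" and K: "compact K" "convex K" "K \<subseteq> S"
  obtains C where "C-lipschitz_on K f"
proof -
  obtain f' where der: "\<And>p. p \<in> S \<Longrightarrow>
        (f has_derivative (\<lambda>v. \<Sum>b\<in>Basis. (v \<bullet> b) * f' b p)) (at p within S)"
      and cont: "\<And>b. b \<in> Basis \<Longrightarrow> continuous_on S (f' b)"
    using f by auto
  have "\<exists>c. \<forall>p\<in>K. \<bar>f' b p\<bar> \<le> c" if "b \<in> Basis" for b
  proof -
    have "bounded (f' b ` K)"
      by (intro compact_imp_bounded compact_continuous_image
          continuous_on_subset[OF cont[OF that] K(3)] K(1))
    then show ?thesis by (auto simp: bounded_iff)
  qed
  then obtain c where c: "\<And>b p. b \<in> Basis \<Longrightarrow> p \<in> K \<Longrightarrow> \<bar>f' b p\<bar> \<le> c b" by metis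
  \<comment> \<open>Each coordinate of \<open>v\<close> is at most \<open>norm v\<close> in absolute
    value, so the summed bounds on the partial derivatives dominate the operator norm of the
    derivative.\<close>
  define C where "C = (\<Sum>b\<in>Basis. \<bar>c b\<bar>)"
  have "C-lipschitz_on K f"
  proof (rule lipschitz_onI)
    show "0 \<le> C" by (simp add: C_def sum_nonneg)
    fix x y assume xy: "x \<in> K" "y \<in> K"
    have "norm (f x - f y) \<le> C * norm (x - y)"
    proof (rule differentiable_bound[OF K(2) _ _ xy])
      fix p assume p: "p \<in> K"
      show "(f has_derivative (\<lambda>v. \<Sum>b\<in>Basis. (v \<bullet> b) * f' b p)) (at p within K)"
        using der has_derivative_subset K(3) p by blast
      show "onorm (\<lambda>v. \<Sum>b\<in>Basis. (v \<bullet> b) * f' b p) \<le> C"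
      proof (rule onorm_le)
        fix v :: 'a
        have "norm (\<Sum>b\<in>Basis. (v \<bullet> b) * f' b p) \<le> (\<Sum>b\<in>Basis. norm v * \<bar>c b\<bar>)"
        proof (rule sum_norm_le)
          fix b :: 'a assume b: "b \<in> Basis"
          have "\<bar>v \<bullet> b\<bar> * \<bar>f' b p\<bar> \<le> norm v * \<bar>c b\<bar>"
            using c[OF b p] Basis_le_norm[OF b, of v] by (intro mult_mono) auto
          then show "norm ((v \<bullet> b) * f' b p) \<le> norm v * \<bar>c b\<bar>" by (simp add: abs_mult)
        qed
        then show "norm (\<Sum>b\<in>Basis. (v \<bullet> b) * f' b p) \<le> C * norm v"
          by (simp add: C_def sum_distrib_left mult.commute)
      qed
    qed
    then show "dist (f x) (f y) \<le> C * dist x y" by (simp add: dist_norm)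
  qed
  then show ?thesis by (rule that)
qed

lemma lipschitz_on_compact_bounded:
  fixes f :: "'a::metric_space \<Rightarrow> real"
  assumes "C-lipschitz_on K f" "compact K"
  obtains c where "c \<ge> 0" "\<And>x. x \<in> K \<Longrightarrow> \<bar>f x\<bar> \<le> c"
proof -
  have "bounded (f ` K)"
    using assms by (intro compact_imp_bounded compact_continuous_image lipschitz_on_continuous_on)
  then obtain c where "\<And>x. x \<in> K \<Longrightarrow> \<bar>f x\<bar> \<le> c" by (auto simp: bounded_iff)
  then have "\<And>x. x \<in> K \<Longrightarrow> \<bar>f x\<bar> \<le> \<bar>c\<bar>" by force
  with that[of "\<bar>c\<bar>"] show ?thesis by simp
qed

lemma lipschitz_on_mult_bounded:
  fixes f g :: "'a::metric_space \<Rightarrow> real"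
  assumes f: "C-lipschitz_on X f" and g: "D-lipschitz_on X g"
    and b: "\<And>x. x \<in> X \<Longrightarrow> \<bar>f x\<bar> \<le> F" "\<And>x. x \<in> X \<Longrightarrow> \<bar>g x\<bar> \<le> G" and "0 \<le> F" "0 \<le> G"
  shows "(F * D + G * C)-lipschitz_on X (\<lambda>x. f x * g x)"
proof (rule lipschitz_onI)
  show "0 \<le> F * D + G * C"
    using assms lipschitz_on_nonneg[OF f] lipschitz_on_nonneg[OF g] by simp
  fix x y assume xy: "x \<in> X" "y \<in> X"
  have "f x * g x - f y * g y = f x * (g x - g y) + g y * (f x - f y)" by (simp add: algebra_simps)
  also have "\<bar>\<dots>\<bar> \<le> \<bar>f x\<bar> * \<bar>g x - g y\<bar> + \<bar>g y\<bar> * \<bar>f x - f y\<bar>"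
    by (metis abs_mult abs_triangle_ineq)
  also have "\<dots> \<le> F * (D * dist x y) + G * (C * dist x y)"
    using lipschitz_onD[OF f xy] lipschitz_onD[OF g xy] b xy assms
    by (intro add_mono mult_mono) (auto simp: dist_real_def)
  finally show "dist (f x * g x) (f y * g y) \<le> (F * D + G * C) * dist x y"
    by (simp add: dist_real_def algebra_simps)
qed

subsection \<open>Difference quotients\<close>

lemma MVT_subinterval:
  fixes f f' :: "real \<Rightarrow> real"
  assumes "continuous_on {p..q} f"
    and "\<And>x. x \<in> {p<..<q} \<Longrightarrow> (f has_real_derivative f' x) (at x)"
    and "p \<le> x" "x < y" "y \<le> q"
  obtains \<xi> where "\<xi> \<in> {x<..<y}" "f y - f x = f' \<xi> * (y - x)"
proof -
  have "continuous_on {x..y} f"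
    by (rule continuous_on_subset[OF assms(1)]) (use assms(3-5) in auto)
  moreover have "(f has_derivative (\<lambda>v. f' z * v)) (at z)" if "x < z" "z < y" for z
    using assms(2)[of z] assms(3-5) that by (simp add: has_field_derivative_def)
  ultimately obtain \<xi> where "x < \<xi>" "\<xi> < y" "f y - f x = f' \<xi> * (y - x)"
    by (rule mvt[OF \<open>x < y\<close>])
  then show ?thesis using that[of \<xi>] by simp
qed

lemma abs_diff_le_of_deriv_bound:
  fixes f f' :: "real \<Rightarrow> real"
  assumes cont: "continuous_on {p..q} f"
    and der: "\<And>x. x \<in> {p<..<q} \<Longrightarrow> (f has_real_derivative f' x) (at x)"
    and bnd: "\<And>x. x \<in> {p<..<q} \<Longrightarrow> \<bar>f' x\<bar> \<le> K"
    and xy: "x \<in> {p..q}" "y \<in> {p..q}"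
  shows "\<bar>f x - f y\<bar> \<le> K * \<bar>x - y\<bar>"
proof -
  have *: "\<bar>f y - f x\<bar> \<le> K * \<bar>y - x\<bar>" if lt: "x < y" "x \<in> {p..q}" "y \<in> {p..q}" for x y
  proof -
    obtain \<xi> where \<xi>: "\<xi> \<in> {x<..<y}" "f y - f x = f' \<xi> * (y - x)"
      by (rule MVT_subinterval[where x = x and y = y, OF cont der])
      (use lt in auto)
    have "\<bar>f' \<xi>\<bar> \<le> K" using \<xi>(1) that by (intro bnd) auto
    then show ?thesis using \<xi>(2) by (simp add: abs_mult mult_right_mono)
  qed
  from *[of x y] *[of y x] xy show ?thesis by (cases x y rule: linorder_cases) (auto simp: abs_minus_commute)
qed

text \<open>The quotient equals \<open>f'\<close> at an interior point between \<open>x\<close> and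
  \<open>y\<close>, and the bound on \<open>f''\<close> controls how far \<open>f'\<close> moves
  from there to \<open>x\<close>. Hence \<open>y\<close> may be an endpoint. Both signs of
  \<open>y - x\<close> occur later: forward quotients in time, backward quotients in space.\<close>

lemma difference_quotient_error:
  fixes f f' f'' :: "real \<Rightarrow> real"
  assumes cont: "continuous_on {p..q} f"
    and der: "\<And>x. x \<in> {p<..<q} \<Longrightarrow> (f has_real_derivative f' x) (at x)"
    and der2: "\<And>x. x \<in> {p<..<q} \<Longrightarrow> (f' has_real_derivative f'' x) (at x)"
    and bnd: "\<And>x. x \<in> {p<..<q} \<Longrightarrow> \<bar>f'' x\<bar> \<le> K"
    and xy: "x \<in> {p<..<q}" "y \<in> {p..q}" "x \<noteq> y"
  shows "\<bar>(f y - f x) / (y - x) - f' x\<bar> \<le> K * \<bar>y - x\<bar>"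
proof -
  have K: "0 \<le> K" using bnd[OF xy(1)] by linarith
  obtain \<xi> where \<xi>: "\<xi> \<in> {p<..<q}" "\<bar>\<xi> - x\<bar> \<le> \<bar>y - x\<bar>" "(f y - f x) / (y - x) = f' \<xi>"
  proof (cases "x < y")
    case True
    obtain \<xi> where "\<xi> \<in> {x<..<y}" "f y - f x = f' \<xi> * (y - x)"
      by (rule MVT_subinterval[where x = x and y = y, OF cont der])
      (use xy True in auto)
    then show ?thesis using that[of \<xi>] xy by auto
  next
    case False
    then have "y < x" using xy by simp
    obtain \<xi> where "\<xi> \<in> {y<..<x}" "f x - f y = f' \<xi> * (x - y)"
      by (rule MVT_subinterval[where x = y and y = x, OF cont der])
      (use xy \<open>y < x\<close> in auto)
    then show ?thesis using that[of \<xi>] xy by (auto simp: field_simps)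
  qed
  have "continuous_on {min \<xi> x..max \<xi> x} f'"
    using xy \<xi>(1) by (intro continuous_at_imp_continuous_on ballI DERIV_isCont[OF der2]) auto
  then have "\<bar>f' \<xi> - f' x\<bar> \<le> K * \<bar>\<xi> - x\<bar>"
    by (rule abs_diff_le_of_deriv_bound[where f' = f''])
       (use xy \<xi>(1) in \<open>auto intro: der2 bnd simp: min_def max_def split: if_splits\<close>)
  also have "\<dots> \<le> K * \<bar>y - x\<bar>" using \<xi>(2) K by (rule mult_left_mono)
  finally show ?thesis using \<xi>(3) by simp
qed

text \<open>Two secants through \<open>p\<close> are compared because no derivative at
  \<open>p\<close> is at hand; each secant slope is a value of \<open>f'\<close> inside the
  interval. The bound does not depend on \<open>y\<close>, which leaves room for the limit
  \<open>y\<close> to \<open>p\<close>.\<close>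

lemma difference_quotients_at_endpoint:
  fixes f f' f'' :: "real \<Rightarrow> real"
  assumes cont: "continuous_on {p..q} f"
    and der: "\<And>x. x \<in> {p<..<q} \<Longrightarrow> (f has_real_derivative f' x) (at x)"
    and der2: "\<And>x. x \<in> {p<..<q} \<Longrightarrow> (f' has_real_derivative f'' x) (at x)"
    and bnd: "\<And>x. x \<in> {p<..<q} \<Longrightarrow> \<bar>f'' x\<bar> \<le> K"
    and yz: "p < y" "y < z" "z \<le> q"
  shows "\<bar>(f z - f p) / (z - p) - (f y - f p) / (y - p)\<bar> \<le> K * (z - p)"
proof -
  have K: "0 \<le> K" using bnd[of y] yz by auto
  obtain \<xi> where \<xi>: "\<xi> \<in> {p<..<y}" "f y - f p = f' \<xi> * (y - p)"
    by (rule MVT_subinterval[where x = p and y = y, OF cont der])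
      (use yz in auto)
  obtain \<eta> where \<eta>: "\<eta> \<in> {p<..<z}" "f z - f p = f' \<eta> * (z - p)"
    by (rule MVT_subinterval[where x = p and y = z, OF cont der])
      (use yz in auto)
  have "continuous_on {min \<xi> \<eta>..max \<xi> \<eta>} f'"
    using yz \<xi>(1) \<eta>(1) by (intro continuous_at_imp_continuous_on ballI DERIV_isCont[OF der2]) auto
  then have "\<bar>f' \<eta> - f' \<xi>\<bar> \<le> K * \<bar>\<eta> - \<xi>\<bar>"
    by (rule abs_diff_le_of_deriv_bound[where f' = f''])
       (use yz \<xi>(1) \<eta>(1) in \<open>auto intro: der2 bnd simp: min_def max_def split: if_splits\<close>)
  also have "\<dots> \<le> K * (z - p)" using \<xi>(1) \<eta>(1) yz K by (intro mult_left_mono) auto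
  finally show ?thesis using \<xi>(2) \<eta>(2) yz by simp
qed

text \<open>Rolle's theorem for an auxiliary function, followed by the mean value theorem for
  \<open>f'\<close>, shows that the second difference is exactly \<open>f''\<close> at a point
  within distance \<open>h\<close> of \<open>x\<close>. The outer nodes may be endpoints of the
  interval.\<close>

lemma second_difference_error:
  fixes f f' f'' f''' :: "real \<Rightarrow> real"
  assumes cont: "continuous_on {p..q} f"
    and der: "\<And>x. x \<in> {p<..<q} \<Longrightarrow> (f has_real_derivative f' x) (at x)"
    and der2: "\<And>x. x \<in> {p<..<q} \<Longrightarrow> (f' has_real_derivative f'' x) (at x)"
    and der3: "\<And>x. x \<in> {p<..<q} \<Longrightarrow> (f'' has_real_derivative f''' x) (at x)"
    and bnd: "\<And>x. x \<in> {p<..<q} \<Longrightarrow> \<bar>f''' x\<bar> \<le> K"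
    and x: "0 < h" "p \<le> x - h" "x + h \<le> q"
  shows "\<bar>(f (x + h) + f (x - h) - 2 * f x) / h\<^sup>2 - f'' x\<bar> \<le> K * h"
proof -
  define A where "A = f (x + h) + f (x - h) - 2 * f x"
  \<comment> \<open>The multiple of \<open>s\<^sup>2\<close> is chosen so that \<open>F h\<close>
    and \<open>F 0\<close> both equal \<open>2 * f x * h\<^sup>2\<close>. A zero of the derivative
    of \<open>F\<close> then equates \<open>A / h\<^sup>2\<close> with a central difference quotient
    of \<open>f'\<close>.\<close>
  define F where "F s = (f (x + s) + f (x - s)) * h\<^sup>2 - A * s\<^sup>2" for s
  have cF: "continuous_on {0..h} F"
    unfolding F_def using x
    by (intro continuous_intros continuous_on_compose2[OF cont]) auto
  have F0: "F h - F 0 = 0" by (simp add: F_def A_def algebra_simps)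
  have dF: "(F has_real_derivative (f' (x + s) - f' (x - s)) * h\<^sup>2 - A * (2 * s)) (at s)"
    if "s \<in> {0<..<h}" for s
    unfolding F_def using that x
    by (auto intro!: derivative_eq_intros DERIV_chain2[where f = f, OF der] simp: algebra_simps)
  obtain s where s: "s \<in> {0<..<h}" "(f' (x + s) - f' (x - s)) * h\<^sup>2 - A * (2 * s) = 0"
    by (rule MVT_subinterval[OF cF dF, of 0 h]) (use x(1) F0 in auto)
  have "continuous_on {x - s..x + s} f'"
    using x s(1) by (intro continuous_at_imp_continuous_on ballI DERIV_isCont[OF der2]) auto
  then obtain \<eta> where \<eta>: "\<eta> \<in> {x - s<..<x + s}" "f' (x + s) - f' (x - s) = f'' \<eta> * (x + s - (x - s))"
    by (rule MVT_subinterval[where p = "x - s" and q = "x + s" and f = f' and f' = f''])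
      (use s(1) x in \<open>auto intro: der2\<close>)
  have "A / h\<^sup>2 = f'' \<eta>" using s \<eta>(2) x(1) by (simp add: field_simps)
  moreover have "\<bar>f'' \<eta> - f'' x\<bar> \<le> K * \<bar>\<eta> - x\<bar>"
  proof (rule abs_diff_le_of_deriv_bound[where f' = f'''])
    show "continuous_on {min \<eta> x..max \<eta> x} f''"
      using x s(1) \<eta>(1) by (intro continuous_at_imp_continuous_on ballI DERIV_isCont[OF der3]) auto
  qed (use x s(1) \<eta>(1) in \<open>auto intro!: der3 bnd simp: min_def max_def split: if_splits\<close>)
  moreover have "K * \<bar>\<eta> - x\<bar> \<le> K * h"
    using bnd[of x] x s(1) \<eta>(1) by (intro mult_left_mono) auto
  ultimately show ?thesis by (simp add: A_def)
qed

subsection \<open>Quadrature\<close>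

lemma space_step_pos: "a > 0 \<Longrightarrow> space_step a M' > 0"
  by (simp add: space_step_def space_pts_def)

lemma space_pts_mult_space_step: "real (space_pts M') * space_step a M' = a"
  by (simp add: space_step_def space_pts_def)

lemma grid_point_bounds:
  assumes "a > 0" "j \<le> space_pts M'"
  shows "real j * space_step a M' \<in> {0..a}"
proof -
  have "real j * space_step a M' \<le> real (space_pts M') * space_step a M'"
    using assms space_step_pos[of a M'] by (intro mult_right_mono) auto
  then show ?thesis using assms space_step_pos[of a M'] by (simp add: space_pts_mult_space_step)
qed

lemma quad_diff: "quad h M' V - quad h M' W = quad h M' (\<lambda>j. V j - W j)"
  unfolding quad_def by (simp add: algebra_simps sum.distrib sum_subtractf sum_distrib_left)

text \<open>Stability of the rule: the absolute values of its weights sum to at most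
  \<open>(2 * M' + 40 / 3) * h\<close>, below \<open>3 * a = (6 * M' + 18) * h\<close>. This bounds
  the discrete populations for every grid and carries nodewise errors through the outer
  quadrature.\<close>

lemma abs_quad_le:
  assumes "a > 0" and V: "\<And>j. j < space_pts M' \<Longrightarrow> \<bar>V j\<bar> \<le> C"
  shows "\<bar>quad (space_step a M') M' V\<bar> \<le> 3 * a * C"
proof -
  define h where "h = space_step a M'"
  have h: "h > 0" "a = (2 * real M' + 6) * h"
    using space_step_pos[OF assms(1)] space_pts_mult_space_step[of M' a]
    by (simp_all add: h_def space_pts_def)
  have C: "0 \<le> C" using V[of 0] by (simp add: space_pts_def)
  define S where "S = (\<Sum>i=2..M'. V (2 * i) + 4 * V (2 * i + 1) + V (2 * i + 2))"
  have "\<bar>S\<bar> \<le> (\<Sum>i=2..M'. 6 * C)"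
    unfolding S_def
  proof (rule order_trans[OF sum_abs sum_mono])
    fix i assume "i \<in> {2..M'}"
    then have "2 * i + 2 < space_pts M'" by (simp add: space_pts_def)
    then show "\<bar>V (2 * i) + 4 * V (2 * i + 1) + V (2 * i + 2)\<bar> \<le> 6 * C"
      using V[of "2 * i"] V[of "2 * i + 1"] V[of "2 * i + 2"] by linarith
  qed
  also have "\<dots> \<le> 6 * (real M' * C)" using C by (simp add: mult_right_mono)
  finally have S: "\<bar>S\<bar> \<le> 6 * (real M' * C)" .
  define A where "A = 2 * V 1 - V 2 + 2 * V 3"
  define Z where "Z = 2 * V (2 * M' + 3) - V (2 * M' + 4) + 2 * V (2 * M' + 5)"
  have A: "\<bar>A\<bar> \<le> 5 * C" using V[of 1] V[of 2] V[of 3] by (simp add: space_pts_def A_def)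
  have Z: "\<bar>Z\<bar> \<le> 5 * C" using V[of "2 * M' + 3"] V[of "2 * M' + 4"] V[of "2 * M' + 5"]
    by (simp add: space_pts_def Z_def)
  have "quad h M' V = h * ((4 * A + S + 4 * Z) / 3)"
    by (simp add: quad_def A_def Z_def S_def field_simps)
  then have "\<bar>quad h M' V\<bar> = \<bar>h\<bar> * \<bar>(4 * A + S + 4 * Z) / 3\<bar>" by (simp only: abs_mult)
  also have "\<bar>h\<bar> = h" using h(1) by simp
  also have "h * \<bar>(4 * A + S + 4 * Z) / 3\<bar> \<le> h * (3 * (2 * real M' + 6) * C)"
    using A S Z C h by (intro mult_left_mono) (auto simp: algebra_simps)
  also have "\<dots> = 3 * ((2 * real M' + 6) * h) * C" by simp
  also have "\<dots> = 3 * a * C" by (simp only: h(2)[symmetric])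
  finally show ?thesis unfolding h_def .
qed

text \<open>The weights of each panel rule add up to the panel length, so \<open>w * f p\<close> is
  a reference value with which both the rule and the integral can be compared.\<close>

lemma integral_deviation:
  fixes f :: "real \<Rightarrow> real"
  assumes f: "C-lipschitz_on {p..p + w} f" and "0 \<le> w"
  shows "\<bar>integral {p..p + w} f - w * f p\<bar> \<le> C * w\<^sup>2"
proof -
  have cont: "continuous_on {p..p + w} f" by (rule lipschitz_on_continuous_on[OF f])
  have "norm (integral {p..p + w} (\<lambda>x. f x - f p)) \<le> (C * w) * (p + w - p)"
  proof (rule integral_bound)
    fix x assume x: "x \<in> {p..p + w}"
    have "\<bar>f x - f p\<bar> \<le> C * \<bar>x - p\<bar>" using lipschitz_onD[OF f x, of p] assms by (simp add: dist_real_def)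
    also have "\<dots> \<le> C * w" using x lipschitz_on_nonneg[OF f] by (intro mult_left_mono) auto
    finally show "norm (f x - f p) \<le> C * w" by simp
  qed (use assms in \<open>auto intro!: continuous_intros cont\<close>)
  moreover have "integral {p..p + w} (\<lambda>x. f x - f p) = integral {p..p + w} f - w * f p"
    using assms by (subst integral_diff) (auto intro: integrable_continuous_interval cont)
  ultimately show ?thesis by (simp add: power2_eq_square)
qed

text \<open>This is Milne's open three-point rule. The nodes lie at distances \<open>h\<close>,
  \<open>2 * h\<close>, \<open>3 * h\<close> from \<open>p\<close>, which gives
  \<open>2 * 1 + 1 * 2 + 2 * 3 = 10\<close> in the bound for \<open>D\<close>; together with the
  integral, \<open>40 / 3 + 16\<close> is rounded up to 30.\<close>

lemma open_panel_error:
  fixes f :: "real \<Rightarrow> real"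
  assumes f: "C-lipschitz_on {p..p + 4 * h} f" and h: "0 < h"
  shows "\<bar>4 * h / 3 * (2 * f (p + h) - f (p + 2 * h) + 2 * f (p + 3 * h)) - integral {p..p + 4 * h} f\<bar>
    \<le> 30 * C * h\<^sup>2"
proof -
  have C: "0 \<le> C" by (rule lipschitz_on_nonneg[OF f])
  have dev: "\<bar>f (p + r * h) - f p\<bar> \<le> C * (r * h)" if "0 \<le> r" "r \<le> 4" for r
    using lipschitz_onD[OF f, of "p + r * h" p] that h
    by (auto simp: dist_real_def mult_right_mono)
  define D where "D = 2 * (f (p + h) - f p) - (f (p + 2 * h) - f p) + 2 * (f (p + 3 * h) - f p)"
  have "\<bar>D\<bar> \<le> 10 * (C * h)" using dev[of 1] dev[of 2] dev[of 3] by (simp add: D_def)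
  then have "\<bar>4 * h / 3 * D\<bar> \<le> 4 * h / 3 * (10 * (C * h))"
    using h by (simp add: abs_mult mult_left_mono)
  also have "\<dots> = 40 / 3 * (C * h\<^sup>2)" by (simp add: power2_eq_square)
  finally have D: "\<bar>4 * h / 3 * D\<bar> \<le> 40 / 3 * (C * h\<^sup>2)" .
  have I: "\<bar>integral {p..p + 4 * h} f - 4 * h * f p\<bar> \<le> 16 * (C * h\<^sup>2)"
    using integral_deviation[OF f] h by (simp add: power_mult_distrib)
  have "4 * h / 3 * (2 * f (p + h) - f (p + 2 * h) + 2 * f (p + 3 * h)) = 4 * h / 3 * D + 4 * h * f p"
    by (simp add: D_def field_simps)
  moreover have "0 \<le> C * h\<^sup>2" using C by simp
  ultimately show ?thesis using D I by linarith
qed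

lemma simpson_panel_error:
  fixes f :: "real \<Rightarrow> real"
  assumes f: "C-lipschitz_on {p..p + 2 * h} f" and h: "0 < h"
  shows "\<bar>h / 3 * (f p + 4 * f (p + h) + f (p + 2 * h)) - integral {p..p + 2 * h} f\<bar> \<le> 6 * C * h\<^sup>2"
proof -
  have dev: "\<bar>f (p + r * h) - f p\<bar> \<le> C * (r * h)" if "0 \<le> r" "r \<le> 2" for r
    using lipschitz_onD[OF f, of "p + r * h" p] that h
    by (auto simp: dist_real_def mult_right_mono)
  define D where "D = 4 * (f (p + h) - f p) + (f (p + 2 * h) - f p)"
  have "\<bar>D\<bar> \<le> 6 * (C * h)" using dev[of 1] dev[of 2] by (simp add: D_def)
  then have "\<bar>h / 3 * D\<bar> \<le> h / 3 * (6 * (C * h))"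
    using h by (simp add: abs_mult mult_left_mono)
  also have "\<dots> = 2 * (C * h\<^sup>2)" by (simp add: power2_eq_square)
  finally have D: "\<bar>h / 3 * D\<bar> \<le> 2 * (C * h\<^sup>2)" .
  have I: "\<bar>integral {p..p + 2 * h} f - 2 * h * f p\<bar> \<le> 4 * (C * h\<^sup>2)"
    using integral_deviation[OF f] h by (simp add: power_mult_distrib)
  have "h / 3 * (f p + 4 * f (p + h) + f (p + 2 * h)) = h / 3 * D + 2 * h * f p"
    by (simp add: D_def field_simps)
  then show ?thesis using D I by linarith
qed

text \<open>For \<open>M' = 0\<close> the two outer panels of the quadrature rule overlap and the rule is inconsistent.\<close>

lemma quad_error:
  fixes f :: "real \<Rightarrow> real"
  assumes a: "a > 0" and f: "C-lipschitz_on {0..a} f" and M': "1 \<le> M'"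
  defines "h \<equiv> space_step a M'"
  shows "\<bar>quad h M' (\<lambda>j. f (real j * h)) - integral {0..a} f\<bar> \<le> 10 * C * a * h"
proof -
  have h: "h > 0" "a = (2 * real M' + 6) * h"
    using space_step_pos[OF a] space_pts_mult_space_step[of M' a]
    by (simp_all add: h_def space_pts_def)
  have C: "0 \<le> C" by (rule lipschitz_on_nonneg[OF f])
  have le_a: "r * h \<le> a" if "r \<le> 2 * real M' + 6" for r
    using that h by (simp add: mult_right_mono)
  have int: "f integrable_on {p..q}" if "0 \<le> p" "q \<le> a" for p q
    using that by (intro integrable_continuous_interval
        continuous_on_subset[OF lipschitz_on_continuous_on[OF f]]) auto
  \<comment> \<open>Simpson panels are added one at a time. At \<open>m = 1\<close> the sum is empty
    and the interval shrinks to the point \<open>4 * h\<close>, the right end of the first open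
    panel.\<close>
  have middle: "\<bar>h / 3 * (\<Sum>i=2..m. f (real (2 * i) * h) + 4 * f (real (2 * i + 1) * h)
          + f (real (2 * i + 2) * h)) - integral {4 * h..(2 * real m + 2) * h} f\<bar>
        \<le> 6 * real m * C * h\<^sup>2" if "1 \<le> m" "m \<le> M'" for m
    using that
  proof (induction m rule: nat_induct_at_least)
    case base
    then show ?case using C by simp
  next
    case (Suc m)
    let ?p = "real (2 * Suc m) * h"
    have p: "?p = (2 * real m + 2) * h" "?p + h = real (2 * Suc m + 1) * h"
      "?p + 2 * h = real (2 * Suc m + 2) * h"
      "(2 * real (Suc m) + 2) * h = ?p + 2 * h"
      by (simp_all add: algebra_simps)
    have bounds: "4 * h \<le> ?p" "?p + 2 * h \<le> a"
    proof -
      show "4 * h \<le> ?p" using Suc.hyps h by (intro mult_right_mono) auto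
      show "?p + 2 * h \<le> a" unfolding p(3) using Suc.prems by (intro le_a) simp
    qed
    have panel: "\<bar>h / 3 * (f ?p + 4 * f (?p + h) + f (?p + 2 * h)) - integral {?p..?p + 2 * h} f\<bar>
        \<le> 6 * C * h\<^sup>2"
      using bounds h by (intro simpson_panel_error lipschitz_on_subset[OF f]) auto
    have split: "integral {4 * h..?p + 2 * h} f = integral {4 * h..?p} f + integral {?p..?p + 2 * h} f"
      using bounds h by (intro Henstock_Kurzweil_Integration.integral_combine[symmetric] int) auto
    define S where "S n = (\<Sum>i=2..n. f (real (2 * i) * h) + 4 * f (real (2 * i + 1) * h)
          + f (real (2 * i + 2) * h))" for n
    define P where "P = f ?p + 4 * f (?p + h) + f (?p + 2 * h)"
    have "S (Suc m) = S m + P"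
      unfolding S_def P_def p(2,3) using Suc.hyps by (subst sum.nat_ivl_Suc') auto
    then have sum: "h / 3 * S (Suc m) = h / 3 * S m + h / 3 * P" by (simp only: distrib_left)
    have IH: "\<bar>h / 3 * S m - integral {4 * h..?p} f\<bar> \<le> 6 * real m * C * h\<^sup>2"
      using Suc.IH Suc.prems unfolding p(1) S_def by simp
    have "\<bar>h / 3 * S (Suc m) - integral {4 * h..?p + 2 * h} f\<bar>
        \<le> 6 * real m * C * h\<^sup>2 + 6 * C * h\<^sup>2"
      using IH panel[folded P_def] unfolding sum split by linarith
    also have "\<dots> = 6 * real (Suc m) * C * h\<^sup>2" by (simp add: algebra_simps)
    finally show ?case unfolding S_def p(4) .
  qed
  \<comment> \<open>This is the left end of the last open panel. The inequality
    \<open>4 * h \<le> ?q\<close>, which keeps the two open panels from overlapping, is where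
    \<open>1 \<le> M'\<close> enters.\<close>
  let ?q = "(2 * real M' + 2) * h"
  have q: "4 * h \<le> ?q" "?q \<le> a" "?q + 4 * h = a"
    using M' h by (auto intro!: mult_right_mono simp: algebra_simps)
  have first: "\<bar>4 * h / 3 * (2 * f h - f (2 * h) + 2 * f (3 * h)) - integral {0..4 * h} f\<bar> \<le> 30 * C * h\<^sup>2"
    using open_panel_error[of C 0 h f] q h by (simp add: lipschitz_on_subset[OF f])
  have "\<bar>4 * h / 3 * (2 * f (?q + h) - f (?q + 2 * h) + 2 * f (?q + 3 * h)) - integral {?q..?q + 4 * h} f\<bar>
      \<le> 30 * C * h\<^sup>2"
    using q h by (intro open_panel_error lipschitz_on_subset[OF f]) auto
  moreover have "?q + h = real (2 * M' + 3) * h" "?q + 2 * h = real (2 * M' + 4) * h"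
    "?q + 3 * h = real (2 * M' + 5) * h" by (simp_all add: algebra_simps)
  ultimately have last: "\<bar>4 * h / 3 * (2 * f (real (2 * M' + 3) * h) - f (real (2 * M' + 4) * h)
      + 2 * f (real (2 * M' + 5) * h)) - integral {?q..a} f\<bar> \<le> 30 * C * h\<^sup>2"
    using q(3) by metis
  have "integral {0..a} f = integral {0..?q} f + integral {?q..a} f"
    using q h by (intro Henstock_Kurzweil_Integration.integral_combine[symmetric] int) auto
  also have "integral {0..?q} f = integral {0..4 * h} f + integral {4 * h..?q} f"
    using q h by (intro Henstock_Kurzweil_Integration.integral_combine[symmetric] int) auto
  finally have "\<bar>quad h M' (\<lambda>j. f (real j * h)) - integral {0..a} f\<bar>
      \<le> 30 * C * h\<^sup>2 + 6 * real M' * C * h\<^sup>2 + 30 * C * h\<^sup>2"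
    using first last middle[OF M' order_refl] unfolding quad_def by simp
  also have "\<dots> = (6 * real M' + 60) * (C * h\<^sup>2)" by (simp add: algebra_simps)
  \<comment> \<open>Enlarging 6 to 20 produces the factor \<open>10 * (2 * M' + 6)\<close>, which is
    \<open>10 * a / h\<close>: order \<open>h\<^sup>2\<close> per panel becomes order
    \<open>h\<close> overall.\<close>
  also have "\<dots> \<le> (20 * real M' + 60) * (C * h\<^sup>2)" using C by (intro mult_right_mono) auto
  also have "\<dots> = 10 * C * a * h" by (simp add: h(2) power2_eq_square algebra_simps)
  finally show ?thesis .
qed

section \<open>Continuity in time, for passing from open to closed time intervals\<close>

lemma continuous_le_on_Icc:
  fixes g :: "real \<Rightarrow> real"
  assumes "p < q" "continuous_on {p..q} g" "\<And>t. t \<in> {p<..<q} \<Longrightarrow> g t \<le> c" "t \<in> {p..q}"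
  shows "g t \<le> c"
  using continuous_le_on_closure[of "{p<..<q}" g t c] assms by simp

lemma continuous_on_quad:
  assumes "\<And>j. j < space_pts M' \<Longrightarrow> continuous_on X (\<lambda>t. V t j)"
  shows "continuous_on X (\<lambda>t. quad h M' (V t))"
  unfolding quad_def by (intro continuous_intros assms) (auto simp: space_pts_def)

subsection \<open>Residuals of a smooth solution\<close>

text \<open>One constant \<open>K\<close> bounds \<open>u\<close> on the closed rectangle and the
  listed derivatives on the open one, except \<open>ut\<close>, whose size never enters an error
  term. The equation and the boundary condition stay outside, so that the coefficients and weights
  remain parameters of the individual estimates.\<close>

locale smooth_profile =
  fixes a T K :: real and u ux uxx uxxx ut utt :: "real \<Rightarrow> real \<Rightarrow> real"
  assumes a_pos: "0 < a" and T_pos: "0 < T"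
    and cont: "continuous_on ({0..a} \<times> {0..T}) (\<lambda>(x, t). u x t)"
    and u_bound: "\<And>x t. x \<in> {0..a} \<Longrightarrow> t \<in> {0..T} \<Longrightarrow> \<bar>u x t\<bar> \<le> K"
    and deriv_x: "\<And>x t. x \<in> {0<..<a} \<Longrightarrow> t \<in> {0<..<T} \<Longrightarrow>
      ((\<lambda>y. u y t) has_real_derivative ux x t) (at x)"
    and deriv_xx: "\<And>x t. x \<in> {0<..<a} \<Longrightarrow> t \<in> {0<..<T} \<Longrightarrow>
      ((\<lambda>y. ux y t) has_real_derivative uxx x t) (at x)"
    and deriv_xxx: "\<And>x t. x \<in> {0<..<a} \<Longrightarrow> t \<in> {0<..<T} \<Longrightarrow>
      ((\<lambda>y. uxx y t) has_real_derivative uxxx x t) (at x)"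
    and deriv_t: "\<And>x t. x \<in> {0<..<a} \<Longrightarrow> t \<in> {0<..<T} \<Longrightarrow>
      ((\<lambda>\<tau>. u x \<tau>) has_real_derivative ut x t) (at t)"
    and deriv_tt: "\<And>x t. x \<in> {0<..<a} \<Longrightarrow> t \<in> {0<..<T} \<Longrightarrow>
      ((\<lambda>\<tau>. ut x \<tau>) has_real_derivative utt x t) (at t)"
    and ux_bound: "\<And>x t. x \<in> {0<..<a} \<Longrightarrow> t \<in> {0<..<T} \<Longrightarrow> \<bar>ux x t\<bar> \<le> K"
    and uxx_bound: "\<And>x t. x \<in> {0<..<a} \<Longrightarrow> t \<in> {0<..<T} \<Longrightarrow> \<bar>uxx x t\<bar> \<le> K"
    and uxxx_bound: "\<And>x t. x \<in> {0<..<a} \<Longrightarrow> t \<in> {0<..<T} \<Longrightarrow> \<bar>uxxx x t\<bar> \<le> K"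
    and utt_bound: "\<And>x t. x \<in> {0<..<a} \<Longrightarrow> t \<in> {0<..<T} \<Longrightarrow> \<bar>utt x t\<bar> \<le> K"
begin

lemma K_nonneg: "0 \<le> K"
  using u_bound[of 0 0] a_pos T_pos by force

lemma continuous_on_x: "t \<in> {0..T} \<Longrightarrow> continuous_on {0..a} (\<lambda>x. u x t)"
  using continuous_on_compose2[OF cont, of "{0..a}" "\<lambda>x. (x, t)"]
  by (force intro: continuous_intros)

lemma continuous_on_t: "x \<in> {0..a} \<Longrightarrow> continuous_on {0..T} (u x)"
  using continuous_on_compose2[OF cont, of "{0..T}" "\<lambda>t. (x, t)"]
  by (force intro: continuous_intros)

text \<open>For open times this is the mean value theorem. For fixed \<open>x\<close> and
  \<open>y\<close> the inequality is closed in \<open>t\<close>, so continuity carries it to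
  \<open>t = 0\<close> and \<open>t = T\<close>.\<close>

lemma lipschitz_on_x:
  assumes "t \<in> {0..T}"
  shows "K-lipschitz_on {0..a} (\<lambda>x. u x t)"
proof (rule lipschitz_onI)
  fix x y assume xy: "x \<in> {0..a}" "y \<in> {0..a}"
  have "\<bar>u x t - u y t\<bar> \<le> K * \<bar>x - y\<bar>"
  proof (rule continuous_le_on_Icc[OF T_pos _ _ assms])
    show "continuous_on {0..T} (\<lambda>t. \<bar>u x t - u y t\<bar>)"
      using xy by (intro continuous_intros continuous_on_t)
    fix t assume t: "t \<in> {0<..<T}"
    show "\<bar>u x t - u y t\<bar> \<le> K * \<bar>x - y\<bar>"
      by (rule abs_diff_le_of_deriv_bound[OF continuous_on_x deriv_x ux_bound xy]) (use t in auto)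
  qed
  then show "dist (u x t) (u y t) \<le> K * dist x y" by (simp add: dist_real_def)
qed (rule K_nonneg)

text \<open>
  The second derivative is only controlled for \<open>0 < t < T\<close>. A bound on the difference of two quotients
  at \<open>x = 0\<close> survives the passage to \<open>t = 0\<close> and \<open>t = T\<close>; only then does one of them tend to \<open>D\<close>.
\<close>

lemma boundary_difference_quotient:
  assumes t: "t \<in> {0..T}" and h: "0 < h" "h \<le> a"
    and der: "((\<lambda>y. u y t) has_real_derivative D) (at 0 within {0..a})"
  shows "\<bar>(u h t - u 0 t) / h - D\<bar> \<le> K * h"
proof -
  have *: "\<bar>(u h t - u 0 t) / h - (u y t - u 0 t) / y\<bar> \<le> K * h" if y: "0 < y" "y < h" for y
  proof (rule continuous_le_on_Icc[OF T_pos _ _ t])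
    show "continuous_on {0..T} (\<lambda>t. \<bar>(u h t - u 0 t) / h - (u y t - u 0 t) / y\<bar>)"
      using h y by (intro continuous_intros continuous_on_t) auto
    fix t assume t: "t \<in> {0<..<T}"
    show "\<bar>(u h t - u 0 t) / h - (u y t - u 0 t) / y\<bar> \<le> K * h"
      using difference_quotients_at_endpoint[OF continuous_on_x deriv_x deriv_xx uxx_bound y h(2)] t
      by simp
  qed
  have lim: "((\<lambda>y. (u y t - u 0 t) / y) \<longlongrightarrow> D) (at 0 within {0..a})"
    using der by (simp add: has_field_derivative_iff)
  have "((\<lambda>y. \<bar>(u h t - u 0 t) / h - (u y t - u 0 t) / y\<bar>) \<longlongrightarrow> \<bar>(u h t - u 0 t) / h - D\<bar>)
      (at 0 within {0..a})"
    by (intro tendsto_intros lim)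
  moreover have "eventually (\<lambda>y. \<bar>(u h t - u 0 t) / h - (u y t - u 0 t) / y\<bar> \<le> K * h)
      (at 0 within {0..a})"
    unfolding eventually_at using h by (intro exI[of _ h]) (auto simp: dist_real_def intro!: *)
  moreover have "at 0 within {0..a} \<noteq> bot"
    using a_pos by (simp add: at_within_Icc_at_right)
  ultimately show ?thesis by (rule tendsto_upperbound)
qed

text \<open>At \<open>t = n * k\<close> this is the inner quadrature of \<open>Phi\<close> applied
  to the nodal values. Time is kept as a real variable so that continuity in \<open>t\<close> can be
  used.\<close>

definition discrete_population :: "nat \<Rightarrow> (real \<Rightarrow> real) \<Rightarrow> real \<Rightarrow> real" where
  "discrete_population M' \<psi> t =
     quad (space_step a M') M' (\<lambda>j. \<psi> (real j * space_step a M') * u (real j * space_step a M') t)"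

lemma continuous_on_discrete_population:
  "continuous_on {0..T} (discrete_population M' \<psi>)"
  unfolding discrete_population_def
  by (intro continuous_on_quad continuous_intros continuous_on_t grid_point_bounds a_pos) simp

context
  fixes \<psi> :: "real \<Rightarrow> real" and C P :: real
  assumes \<psi>: "C-lipschitz_on {0..a} \<psi>" "\<And>x. x \<in> {0..a} \<Longrightarrow> \<bar>\<psi> x\<bar> \<le> P" and P: "0 \<le> P"
begin

lemma product_bound:
  assumes "x \<in> {0..a}" "t \<in> {0..T}"
  shows "\<bar>\<psi> x * u x t\<bar> \<le> P * K"
  unfolding abs_mult using assms \<psi>(2) u_bound P by (intro mult_mono) auto

text \<open>Neither the weight nor \<open>u\<close> has a prescribed sign, hence the symmetric
  interval. Its radius comes from the stability of the quadrature and also exceeds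
  \<open>a * (P * K)\<close>, the bound for the exact population, so one box serves both.\<close>

lemma discrete_population_bound:
  assumes "t \<in> {0..T}"
  shows "discrete_population M' \<psi> t \<in> {- (3 * a * (P * K))..3 * a * (P * K)}"
proof -
  have "\<bar>discrete_population M' \<psi> t\<bar> \<le> 3 * a * (P * K)"
    unfolding discrete_population_def
    by (intro abs_quad_le a_pos product_bound grid_point_bounds assms) simp
  then show ?thesis by auto
qed

lemma weighted_population_bound:
  assumes "t \<in> {0..T}"
  shows "weighted_population a \<psi> u t \<in> {- (3 * a * (P * K))..3 * a * (P * K)}"
proof -
  have "norm (weighted_population a \<psi> u t) \<le> P * K * (a - 0)"
    unfolding weighted_population_def
    using a_pos product_bound assms
    by (intro integral_bound continuous_intros continuous_on_x lipschitz_on_continuous_on[OF \<psi>(1)]) auto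
  also have "\<dots> \<le> 3 * a * (P * K)" using a_pos P K_nonneg by (simp add: mult_ac)
  finally show ?thesis by auto
qed

lemma population_error:
  assumes "t \<in> {0..T}" "1 \<le> M'"
  shows "\<bar>discrete_population M' \<psi> t - weighted_population a \<psi> u t\<bar>
    \<le> 10 * (P * K + K * C) * a * space_step a M'"
  unfolding discrete_population_def weighted_population_def
  by (intro quad_error[where f = "\<lambda>x. \<psi> x * u x t"] lipschitz_on_mult_bounded lipschitz_on_x
      \<psi> u_bound P K_nonneg a_pos assms)

lemma coefficient_error:
  assumes F: "L-lipschitz_on ({0..a} \<times> {- (3 * a * (P * K))..3 * a * (P * K)}) (\<lambda>(x, s). F x s)"
    and x: "x \<in> {0..a}" and t: "t \<in> {0..T}" and M': "1 \<le> M'"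
  shows "\<bar>F x (discrete_population M' \<psi> t) * u x t - F x (weighted_population a \<psi> u t) * u x t\<bar>
    \<le> L * (10 * (P * K + K * C) * a) * K * space_step a M'"
proof -
  let ?p = "discrete_population M' \<psi> t" and ?w = "weighted_population a \<psi> u t"
  have "dist (F x ?p) (F x ?w) \<le> L * dist (x, ?p) (x, ?w)"
    using lipschitz_onD[OF F, of "(x, ?p)" "(x, ?w)"] x
      discrete_population_bound[OF t] weighted_population_bound[OF t] by simp
  \<comment> \<open>The two points share the coordinate \<open>x\<close>, so their distance is just
    the population error.\<close>
  also have "\<dots> \<le> L * (10 * (P * K + K * C) * a * space_step a M')"
    using population_error[OF t M'] lipschitz_on_nonneg[OF F]
    by (intro mult_left_mono) (simp_all add: dist_Pair_Pair dist_real_def)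
  finally have "\<bar>F x ?p - F x ?w\<bar> * \<bar>u x t\<bar> \<le> (L * (10 * (P * K + K * C) * a * space_step a M')) * K"
    using u_bound[OF x t] by (intro mult_mono) (auto simp: dist_real_def)
  moreover have "F x ?p * u x t - F x ?w * u x t = (F x ?p - F x ?w) * u x t"
    by (simp add: left_diff_distrib)
  ultimately show ?thesis by (simp only: abs_mult mult_ac)
qed

text \<open>Three errors add up: the difference quotient at \<open>x = 0\<close>, the replacement of
  the discrete by the exact population inside \<open>B\<close>, and the quadrature of the resulting
  integrand. They contribute \<open>K\<close>, \<open>3 * a * E\<close> and \<open>Q\<close> to the
  constant, none of which depends on the time or the grid.\<close>

lemma boundary_residual:
  assumes B: "L-lipschitz_on ({0..a} \<times> {- (3 * a * (P * K))..3 * a * (P * K)}) (\<lambda>(x, s). B x s)"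
    and bc: "\<And>t. t \<in> {0..T} \<Longrightarrow> \<exists>D. ((\<lambda>y. u y t) has_real_derivative D) (at 0 within {0..a}) \<and>
        u 0 t - D = integral {0..a} (\<lambda>x. B x (weighted_population a \<psi> u t) * u x t)"
  shows "\<exists>R. \<forall>M'\<ge>1. \<forall>t\<in>{0..T}. let h = space_step a M' in
    \<bar>(1 + 1 / h) * u 0 t - 1 / h * u h t
      - quad h M' (\<lambda>j. B (real j * h) (discrete_population M' \<psi> t) * u (real j * h) t)\<bar> \<le> R * h"
proof -
  let ?I = "{- (3 * a * (P * K))..3 * a * (P * K)}"
  obtain \<beta> where "0 \<le> \<beta>" and \<beta>: "\<And>p. p \<in> {0..a} \<times> ?I \<Longrightarrow> \<bar>case p of (x, s) \<Rightarrow> B x s\<bar> \<le> \<beta>"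
    using lipschitz_on_compact_bounded[OF B] by (auto intro: compact_Times)
  define E where "E = L * (10 * (P * K + K * C) * a) * K"
  define Q where "Q = 10 * (\<beta> * K + K * L) * a"
  show ?thesis
  proof (intro exI[of _ "K + 3 * a * E + Q"] allI impI ballI)
    fix M' :: nat and t assume M': "1 \<le> M'" and t: "t \<in> {0..T}"
    define h where "h = space_step a M'"
    let ?w = "weighted_population a \<psi> u t"
    have h: "0 < h" "h \<le> a"
      using space_step_pos[OF a_pos] grid_point_bounds[OF a_pos, of 1 M']
      by (auto simp: h_def space_pts_def)
    obtain D where D: "((\<lambda>y. u y t) has_real_derivative D) (at 0 within {0..a})"
      "u 0 t - D = integral {0..a} (\<lambda>x. B x ?w * u x t)" using bc[OF t] by blast
    have w: "?w \<in> ?I" by (rule weighted_population_bound[OF t])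
    have "L-lipschitz_on {0..a} (\<lambda>x. B x ?w)"
    proof (rule lipschitz_onI)
      fix x y assume "x \<in> {0..a}" "y \<in> {0..a}"
      then show "dist (B x ?w) (B y ?w) \<le> L * dist x y"
        using lipschitz_onD[OF B, of "(x, ?w)" "(y, ?w)"] w by (simp add: dist_Pair_Pair)
    qed (rule lipschitz_on_nonneg[OF B])
    then have lip: "(\<beta> * K + K * L)-lipschitz_on {0..a} (\<lambda>x. B x ?w * u x t)"
      by (rule lipschitz_on_mult_bounded[OF _ lipschitz_on_x[OF t]])
         (use \<beta> w u_bound[OF _ t] K_nonneg \<open>0 \<le> \<beta>\<close> in auto)
    have quadrature: "\<bar>quad h M' (\<lambda>j. B (real j * h) ?w * u (real j * h) t)
        - integral {0..a} (\<lambda>x. B x ?w * u x t)\<bar> \<le> Q * h"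
      unfolding h_def Q_def by (rule quad_error[OF a_pos lip M'])
    have coefficient: "\<bar>quad h M' (\<lambda>j. B (real j * h) (discrete_population M' \<psi> t) * u (real j * h) t)
        - quad h M' (\<lambda>j. B (real j * h) ?w * u (real j * h) t)\<bar> \<le> 3 * a * (E * h)"
      unfolding h_def quad_diff E_def
      by (intro abs_quad_le coefficient_error B t M' grid_point_bounds a_pos) simp
    \<comment> \<open>Adding and subtracting \<open>D\<close> isolates \<open>u 0 t - D\<close>,
      which the boundary condition turns into the exact integral.\<close>
    have "(1 + 1 / h) * u 0 t - 1 / h * u h t = (u 0 t - D) - ((u h t - u 0 t) / h - D)"
      using h by (simp add: field_simps)
    then show "let h = space_step a M' in
      \<bar>(1 + 1 / h) * u 0 t - 1 / h * u h t
        - quad h M' (\<lambda>j. B (real j * h) (discrete_population M' \<psi> t) * u (real j * h) t)\<bar>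
      \<le> (K + 3 * a * E + Q) * h"
      using quadrature coefficient boundary_difference_quotient[OF t h D(1)]
      unfolding Let_def h_def[symmetric] D(2) by (simp add: distrib_right)
  qed
qed

text \<open>The scheme is explicit: the equation is used at the old time \<open>s\<close>, and
  \<open>t\<close> occurs only in the time quotient. Real times instead of grid times allow
  \<open>s\<close> to tend to 0 while \<open>t\<close> stays fixed.\<close>

lemma interior_residual:
  assumes d: "L-lipschitz_on ({0..a} \<times> {- (3 * a * (P * K))..3 * a * (P * K)}) (\<lambda>(x, s). d x s)"
    and pde: "\<And>x t. x \<in> {0<..<a} \<Longrightarrow> t \<in> {0<..<T} \<Longrightarrow>
        ut x t + ux x t + d x (weighted_population a \<psi> u t) * u x t = uxx x t"
  shows "\<exists>R. \<forall>M'\<ge>1. \<forall>i\<in>{1..<space_pts M'}. \<forall>s t. 0 \<le> s \<longrightarrow> s < t \<longrightarrow> t \<le> T \<longrightarrow>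
    (let h = space_step a M'; x = real i * h in
    \<bar>(u x t - u x s) / (t - s) + (u x s - u (x - h) s) / h
      + d x (discrete_population M' \<psi> s) * u x s
      - (u (x + h) s + u (x - h) s - 2 * u x s) / h\<^sup>2\<bar> \<le> R * (h + (t - s)))"
proof -
  define E where "E = L * (10 * (P * K + K * C) * a) * K"
  show ?thesis
  proof (intro exI[of _ "2 * K + \<bar>E\<bar>"] allI impI ballI)
    fix M' i :: nat and s0 t :: real
    assume M': "1 \<le> M'" and i: "i \<in> {1..<space_pts M'}" and st: "0 \<le> s0" "s0 < t" "t \<le> T"
    define h where "h = space_step a M'"
    define x where "x = real i * h"
    have h: "0 < h" using space_step_pos[OF a_pos] by (simp add: h_def)
    have xi: "real (i - 1) * h = x - h" "real (i + 1) * h = x + h"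
      using i by (simp_all add: x_def algebra_simps of_nat_diff)
    have x: "0 \<le> x - h" "x + h \<le> a"
      using grid_point_bounds[OF a_pos, of "i - 1" M'] grid_point_bounds[OF a_pos, of "i + 1" M'] i
      unfolding h_def[symmetric] xi by auto
    then have x': "x \<in> {0<..<a}" using h by auto
    define R where "R s = (u x t - u x s) / (t - s) + (u x s - u (x - h) s) / h
      + d x (discrete_population M' \<psi> s) * u x s
      - (u (x + h) s + u (x - h) s - 2 * u x s) / h\<^sup>2" for s
    \<comment> \<open>The claim is \<open>e s \<le> 0\<close>. Both sides are gathered in one
      function of \<open>s\<close>, to which the extension by continuity applies.\<close>
    define e where "e s = \<bar>R s\<bar> - (2 * K + \<bar>E\<bar>) * (h + (t - s))" for s
    have bound: "e s \<le> 0" if s: "s \<in> {0<..<t}" for s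
    proof -
      have s': "s \<in> {0<..<T}" "s \<in> {0..T}" using s st by auto
      have "\<bar>(u x t - u x s) / (t - s) - ut x s\<bar> \<le> K * \<bar>t - s\<bar>"
        by (rule difference_quotient_error[OF continuous_on_t deriv_t deriv_tt utt_bound])
           (use x' s s' st in auto)
      then have time: "\<bar>(u x t - u x s) / (t - s) - ut x s\<bar> \<le> K * (t - s)" using s by simp
      have "\<bar>(u (x - h) s - u x s) / (x - h - x) - ux x s\<bar> \<le> K * \<bar>x - h - x\<bar>"
        by (rule difference_quotient_error[OF continuous_on_x deriv_x deriv_xx uxx_bound])
           (use x x' h s' in auto)
      moreover have "(u (x - h) s - u x s) / (x - h - x) = (u x s - u (x - h) s) / h"
        using h by (simp add: field_simps)
      ultimately have advection: "\<bar>(u x s - u (x - h) s) / h - ux x s\<bar> \<le> K * h" using h by simp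
      have diffusion: "\<bar>(u (x + h) s + u (x - h) s - 2 * u x s) / h\<^sup>2 - uxx x s\<bar> \<le> K * h"
        by (rule second_difference_error[OF continuous_on_x deriv_x deriv_xx deriv_xxx uxxx_bound])
           (use x x' h s' in auto)
      have "\<bar>d x (discrete_population M' \<psi> s) * u x s - d x (weighted_population a \<psi> u s) * u x s\<bar>
          \<le> E * h"
        unfolding E_def h_def using coefficient_error[OF d _ s'(2) M'] x' by simp
      also have "\<dots> \<le> \<bar>E\<bar> * h" using h by (simp add: mult_right_mono)
      finally have "\<bar>R s\<bar> \<le> K * (t - s) + K * h + \<bar>E\<bar> * h + K * h"
        unfolding R_def using time advection diffusion pde[OF x' s'(1)] by linarith
      moreover have "0 \<le> (K + \<bar>E\<bar>) * (t - s)" using K_nonneg s by simp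
      ultimately show ?thesis by (simp add: e_def algebra_simps)
    qed
    have "e s0 \<le> 0"
    proof (cases "s0 = 0")
      case False
      then show ?thesis using bound st by simp
    next
      \<comment> \<open>The equation is not assumed at time \<open>0\<close>, so the bound is extended there by continuity.\<close>
      case True
      \<comment> \<open>Stopping at \<open>t / 2\<close> keeps \<open>s\<close> away from
        \<open>t\<close>, where the time quotient is singular.\<close>
      have "continuous_on {0..t / 2} (\<lambda>s. (x, discrete_population M' \<psi> s))"
        using st by (intro continuous_intros
            continuous_on_subset[OF continuous_on_discrete_population]) auto
      then have "continuous_on {0..t / 2} (\<lambda>s. d x (discrete_population M' \<psi> s))"
        using continuous_on_compose2[OF lipschitz_on_continuous_on[OF d],
            of "{0..t / 2}" "\<lambda>s. (x, discrete_population M' \<psi> s)"]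
          x' st discrete_population_bound by (simp add: image_subset_iff)
      moreover have "continuous_on {0..t / 2} (u y)" if "y \<in> {0..a}" for y
        using st by (intro continuous_on_subset[OF continuous_on_t[OF that]]) auto
      ultimately have "continuous_on {0..t / 2} e"
        unfolding e_def R_def using x x' h st by (intro continuous_intros) auto
      from continuous_le_on_Icc[OF _ this, of 0] bound st True show ?thesis by simp
    qed
    then show "let h = space_step a M'; x = real i * h in
      \<bar>(u x t - u x s0) / (t - s0) + (u x s0 - u (x - h) s0) / h
        + d x (discrete_population M' \<psi> s0) * u x s0
        - (u (x + h) s0 + u (x - h) s0 - 2 * u x s0) / h\<^sup>2\<bar> \<le> (2 * K + \<bar>E\<bar>) * (h + (t - s0))"
      unfolding Let_def h_def[symmetric] x_def[symmetric] by (simp add: e_def R_def)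
  qed
qed

end

end

section \<open>From the smoothness class to iterated partial derivatives\<close>

lemma Ck_bdd_on_Suc_partials:
  fixes f :: "real \<times> real \<Rightarrow> real"
  assumes f: "Ck_bdd_on (Suc m) S f" and S: "open S"
  obtains fx ft where "bounded (fx ` S)" "bounded (ft ` S)" "Ck_bdd_on m S fx" "Ck_bdd_on m S ft"
    "\<And>x t. (x, t) \<in> S \<Longrightarrow> ((\<lambda>y. f (y, t)) has_real_derivative fx (x, t)) (at x)"
    "\<And>x t. (x, t) \<in> S \<Longrightarrow> ((\<lambda>\<tau>. f (x, \<tau>)) has_real_derivative ft (x, t)) (at t)"
proof -
  have Basis: "(Basis :: (real \<times> real) set) = {(1, 0), (0, 1)}"
    unfolding Basis_prod_def by auto
  obtain f' where der: "\<And>p. p \<in> S \<Longrightarrow>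
      (f has_derivative (\<lambda>v. \<Sum>b\<in>Basis. (v \<bullet> b) * f' b p)) (at p within S)"
    and f': "\<And>b. b \<in> Basis \<Longrightarrow> bounded (f' b ` S) \<and> Ck_bdd_on m S (f' b)"
    using f by auto
  \<comment> \<open>On the open set \<open>S\<close> the derivative relative to \<open>S\<close> is
    the ordinary one. Composition with the embeddings \<open>y\<close> to \<open>(y, t)\<close> and
    \<open>\<tau>\<close> to \<open>(x, \<tau>)\<close> then picks out its two coefficients.\<close>
  have der': "(f has_derivative (\<lambda>v. fst v * f' (1, 0) p + snd v * f' (0, 1) p)) (at p)" if "p \<in> S" for p
    using der[OF that] at_within_open[OF that S] by (simp add: Basis inner_prod_def)
  show ?thesis
  proof (rule that[of "f' (1, 0)" "f' (0, 1)"])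
    fix x t assume p: "(x, t) \<in> S"
    have "((\<lambda>y. (y, t)) has_derivative (\<lambda>v. (v, 0))) (at x)"
      by (auto intro!: derivative_eq_intros)
    from has_derivative_compose[OF this der'[OF p]]
    show "((\<lambda>y. f (y, t)) has_real_derivative f' (1, 0) (x, t)) (at x)"
      by (simp add: has_field_derivative_def mult.commute[of _ "f' _ _"])
    have "((\<lambda>\<tau>. (x, \<tau>)) has_derivative (\<lambda>v. (0, v))) (at t)"
      by (auto intro!: derivative_eq_intros)
    from has_derivative_compose[OF this der'[OF p]]
    show "((\<lambda>\<tau>. f (x, \<tau>)) has_real_derivative f' (0, 1) (x, t)) (at t)"
      by (simp add: has_field_derivative_def mult.commute[of _ "f' _ _"])
  qed (use f' in \<open>auto simp: Basis\<close>)
qed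

text \<open>The derivatives in \<open>solves_P\<close> and those in the smoothness class come from
  separate existential statements. Uniqueness of derivatives identifies them on the open rectangle,
  so the equation holds for the bounded ones.\<close>

lemma solution_smooth_profile:
  assumes "0 < a" "0 < T" and sol: "solves_P a d B \<psi>1 \<psi>2 u0 u"
    and smooth: "Ck_bdd_on 3 ({0<..<a} \<times> {0<..<T}) (\<lambda>(x, t). u x t)"
  obtains K ux uxx uxxx ut utt where "smooth_profile a T K u ux uxx uxxx ut utt"
    "\<And>x t. x \<in> {0<..<a} \<Longrightarrow> t \<in> {0<..<T} \<Longrightarrow>
        ut x t + ux x t + d x (weighted_population a \<psi>1 u t) * u x t = uxx x t"
proof -
  let ?S = "{0<..<a} \<times> {0<..<T}"
  have S: "open ?S" by (simp add: open_Times)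
  have "Ck_bdd_on (Suc 2) ?S (\<lambda>(x, t). u x t)" using smooth by (simp add: numeral_eq_Suc)
  then obtain fx ft where f: "bounded (fx ` ?S)" "bounded (ft ` ?S)"
    "Ck_bdd_on 2 ?S fx" "Ck_bdd_on 2 ?S ft"
    "\<And>x t. (x, t) \<in> ?S \<Longrightarrow> ((\<lambda>y. u y t) has_real_derivative fx (x, t)) (at x)"
    "\<And>x t. (x, t) \<in> ?S \<Longrightarrow> ((\<lambda>\<tau>. u x \<tau>) has_real_derivative ft (x, t)) (at t)"
    by (rule Ck_bdd_on_Suc_partials[OF _ S]) (rule that; simp)
  have "Ck_bdd_on (Suc 1) ?S fx" using f(3) by (simp only: numeral_2_eq_2 One_nat_def)
  then obtain fxx where fxx: "bounded (fxx ` ?S)" "Ck_bdd_on (Suc 0) ?S fxx"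
    "\<And>x t. (x, t) \<in> ?S \<Longrightarrow> ((\<lambda>y. fx (y, t)) has_real_derivative fxx (x, t)) (at x)"
    by (rule Ck_bdd_on_Suc_partials[OF _ S]) (rule that; simp)
  from fxx(2) obtain fxxx where fxxx: "bounded (fxxx ` ?S)"
    "\<And>x t. (x, t) \<in> ?S \<Longrightarrow> ((\<lambda>y. fxx (y, t)) has_real_derivative fxxx (x, t)) (at x)"
    by (rule Ck_bdd_on_Suc_partials[OF _ S]) (rule that; simp)
  have "Ck_bdd_on (Suc 1) ?S ft" using f(4) by (simp only: numeral_2_eq_2 One_nat_def)
  then obtain ftt where ftt: "bounded (ftt ` ?S)"
    "\<And>x t. (x, t) \<in> ?S \<Longrightarrow> ((\<lambda>\<tau>. ft (x, \<tau>)) has_real_derivative ftt (x, t)) (at t)"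
    by (rule Ck_bdd_on_Suc_partials[OF _ S]) (rule that; simp)
  have cont: "continuous_on ({0..a} \<times> {0..T}) (\<lambda>(x, t). u x t)"
    using sol unfolding solves_P_def by (auto intro: continuous_on_subset)
  \<comment> \<open>\<open>Ck_bdd_on\<close> bounds derivatives only; the bound on \<open>u\<close>
    itself comes from compactness of the closed rectangle.\<close>
  have "bounded ((\<lambda>(x, t). u x t) ` ({0..a} \<times> {0..T}))"
    by (intro compact_imp_bounded compact_continuous_image cont compact_Times) auto
  then obtain c where c: "\<And>p. p \<in> {0..a} \<times> {0..T} \<Longrightarrow> \<bar>case p of (x, t) \<Rightarrow> u x t\<bar> \<le> c"
    unfolding bounded_iff real_norm_def by blast
  have bounds: "\<exists>c. \<forall>p\<in>?S. \<bar>g p\<bar> \<le> c" if "bounded (g ` ?S)" for g :: "real \<times> real \<Rightarrow> real"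
    using that by (simp add: bounded_iff)
  obtain cx where cx: "\<forall>p\<in>?S. \<bar>fx p\<bar> \<le> cx" using bounds[OF f(1)] by blast
  obtain cxx where cxx: "\<forall>p\<in>?S. \<bar>fxx p\<bar> \<le> cxx" using bounds[OF fxx(1)] by blast
  obtain cxxx where cxxx: "\<forall>p\<in>?S. \<bar>fxxx p\<bar> \<le> cxxx" using bounds[OF fxxx(1)] by blast
  obtain ctt where ctt: "\<forall>p\<in>?S. \<bar>ftt p\<bar> \<le> ctt" using bounds[OF ftt(1)] by blast
  define K where "K = Max {c, cx, cxx, cxxx, ctt}"
  have K: "c \<le> K" "cx \<le> K" "cxx \<le> K" "cxxx \<le> K" "ctt \<le> K" by (auto simp: K_def)
  show ?thesis
  proof (rule that)
    show "smooth_profile a T K u (\<lambda>x t. fx (x, t)) (\<lambda>x t. fxx (x, t)) (\<lambda>x t. fxxx (x, t))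
        (\<lambda>x t. ft (x, t)) (\<lambda>x t. ftt (x, t))"
    proof
      fix x t assume "x \<in> {0..a}" "t \<in> {0..T}"
      then show "\<bar>u x t\<bar> \<le> K" using c[of "(x, t)"] K by auto
    next
      fix x t assume "x \<in> {0<..<a}" "t \<in> {0<..<T}"
      then have "(x, t) \<in> ?S" by simp
      then show "\<bar>fx (x, t)\<bar> \<le> K" "\<bar>fxx (x, t)\<bar> \<le> K" "\<bar>fxxx (x, t)\<bar> \<le> K" "\<bar>ftt (x, t)\<bar> \<le> K"
        using cx cxx cxxx ctt K by (meson order_trans)+
    qed (use assms cont f fxx fxxx ftt in auto)
    obtain ut ux uxx where interior: "\<And>x t. x \<in> {0<..<a} \<Longrightarrow> t > 0 \<Longrightarrow>
           ((\<lambda>\<tau>. u x \<tau>) has_real_derivative ut x t) (at t) \<and>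
           ((\<lambda>y. u y t) has_real_derivative ux x t) (at x) \<and>
           ((\<lambda>y. ux y t) has_real_derivative uxx x t) (at x) \<and>
           ut x t + ux x t + d x (weighted_population a \<psi>1 u t) * u x t = uxx x t"
      using sol unfolding solves_P_def by blast
    fix x t assume x: "x \<in> {0<..<a}" and t: "t \<in> {0<..<T}"
    have "ut x t = ft (x, t)"
      using DERIV_unique[OF _ f(6)[of x t]] interior x t by auto
    \<comment> \<open>Equality is proved along the whole open interval, since transferring the
      second derivative requires the first ones to agree near \<open>x\<close>.\<close>
    moreover have ux: "ux y t = fx (y, t)" if "y \<in> {0<..<a}" for y
      using DERIV_unique[OF _ f(5)[of y t]] interior that t by auto
    moreover have "((\<lambda>y. fx (y, t)) has_real_derivative uxx x t) (at x)"
      by (rule has_field_derivative_transform_within_open[where f = "\<lambda>y. ux y t" and S = "{0<..<a}"])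
         (use interior x t ux in auto)
    then have "uxx x t = fxx (x, t)" using DERIV_unique[OF _ fxx(3)[of x t]] x t by auto
    ultimately show "ft (x, t) + fx (x, t) + d x (weighted_population a \<psi>1 u t) * u x t = fxx (x, t)"
      using interior[OF x, of t] t x by simp
  qed
qed

subsection \<open>The local discretization error\<close>

lemma space_norm_square_le:
  assumes "0 < a" and "\<And>i. i \<in> {1..<space_pts M'} \<Longrightarrow> \<bar>V i\<bar> \<le> e"
  shows "(space_norm (space_step a M') M' V)\<^sup>2 \<le> a * e\<^sup>2"
proof -
  let ?h = "space_step a M'"
  have h: "0 < ?h" by (rule space_step_pos[OF assms(1)])
  have "(space_norm ?h M' V)\<^sup>2 = (\<Sum>i=1..space_pts M' - 1. ?h * \<bar>V i\<bar>\<^sup>2)"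
    unfolding space_norm_def using h by (intro real_sqrt_pow2 sum_nonneg) simp
  also have "\<dots> \<le> (\<Sum>i=1..space_pts M' - 1. ?h * e\<^sup>2)"
    using h assms(2) by (intro sum_mono mult_left_mono power_mono) (auto simp: space_pts_def)
  also have "\<dots> \<le> real (space_pts M') * (?h * e\<^sup>2)"
    using h by (simp add: mult_right_mono)
  also have "\<dots> = a * e\<^sup>2" by (simp only: mult.assoc[symmetric] space_pts_mult_space_step)
  finally show ?thesis .
qed

text \<open>There are \<open>N + 1\<close> time levels of weight \<open>k\<close>; the extra one is
  absorbed by \<open>N + 1 \<le> 2 * N\<close>, whence the factor 2.\<close>

lemma time_norm_square_le:
  assumes "0 < T" "1 \<le> N" and "\<And>n. n \<le> N \<Longrightarrow> \<bar>Z n\<bar> \<le> e"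
  shows "(time_norm (time_step T N) N Z)\<^sup>2 \<le> 2 * T * e\<^sup>2"
proof -
  let ?k = "time_step T N"
  have k: "0 < ?k" "real N * ?k = T" using assms(1,2) by (simp_all add: time_step_def)
  have "(time_norm ?k N Z)\<^sup>2 = (\<Sum>n=0..N. ?k * \<bar>Z n\<bar>\<^sup>2)"
    unfolding time_norm_def using k by (intro real_sqrt_pow2 sum_nonneg) simp
  also have "\<dots> \<le> (\<Sum>n=0..N. ?k * e\<^sup>2)"
    using k assms(3) by (intro sum_mono mult_left_mono power_mono) auto
  also have "\<dots> = real (N + 1) * (?k * e\<^sup>2)" by simp
  also have "\<dots> \<le> 2 * real N * (?k * e\<^sup>2)" using k(1) assms(2) by (intro mult_right_mono) auto
  also have "\<dots> = 2 * (real N * ?k) * e\<^sup>2" by simp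
  also have "\<dots> = 2 * T * e\<^sup>2" by (simp only: k(2))
  finally show ?thesis .
qed

lemma eventually_refinementI:
  assumes "\<And>M' N. 1 \<le> M' \<Longrightarrow> 1 \<le> N \<Longrightarrow> P (M', N)"
  shows "eventually P refinement"
  unfolding refinement_def eventually_prod_filter
  by (intro exI[of _ "\<lambda>n. 1 \<le> n"] conjI)
     (simp_all add: eventually_principal eventually_ge_at_top assms)

text \<open>The quotient \<open>g\<close> is bounded by \<open>C\<close> for
  \<open>1 \<le> M'\<close> and \<open>1 \<le> N\<close>, so each share is controlled by its own
  squared step. The identity itself holds for every pair: the denominator contains the positive
  \<open>h\<^sup>2\<close>, even at \<open>N = 0\<close>, where \<open>time_step T 0\<close> is
  0.\<close>

lemma split_error_by_step_sizes:
  fixes E :: "nat \<times> nat \<Rightarrow> real"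
  assumes "0 < a" and E: "\<And>M' N. 1 \<le> M' \<Longrightarrow> 1 \<le> N \<Longrightarrow>
    \<bar>E (M', N)\<bar> \<le> C * ((space_step a M')\<^sup>2 + (time_step T N)\<^sup>2)"
  obtains R1 R2 where "R1 \<in> O[refinement](\<lambda>(M', N). (space_step a M')\<^sup>2)"
    "R2 \<in> O[refinement](\<lambda>(M', N). (time_step T N)\<^sup>2)" "\<And>p. R1 p + R2 p = E p"
proof
  let ?s = "\<lambda>(M', N). (space_step a M')\<^sup>2 + (time_step T N)\<^sup>2"
  define g where "g p = E p / ?s p" for p
  define R1 where "R1 p = g p * (case p of (M', N) \<Rightarrow> (space_step a M')\<^sup>2)" for p
  define R2 where "R2 p = g p * (case p of (M', N) \<Rightarrow> (time_step T N)\<^sup>2)" for p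
  have s: "0 < ?s (M', N)" for M' N
    using space_step_pos[OF assms(1), of M'] by (simp add: add_pos_nonneg)
  have g: "\<bar>g (M', N)\<bar> \<le> C" if "1 \<le> M'" "1 \<le> N" for M' N
    using E[OF that] s[of M' N] by (simp add: g_def abs_divide pos_divide_le_eq)
  show "R1 \<in> O[refinement](\<lambda>(M', N). (space_step a M')\<^sup>2)"
    by (rule bigoI[of _ C], rule eventually_refinementI)
       (simp add: R1_def abs_mult g mult_right_mono)
  show "R2 \<in> O[refinement](\<lambda>(M', N). (time_step T N)\<^sup>2)"
    by (rule bigoI[of _ C], rule eventually_refinementI)
       (simp add: R2_def abs_mult g mult_right_mono)
  show "R1 p + R2 p = E p" for p
  proof (cases p)
    case (Pair M' N)
    then show ?thesis unfolding R1_def R2_def distrib_left[symmetric] using space_step_pos[OF assms(1), of M'] by (simp add: g_def)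
  qed
qed

theorem theorem3p1:
  fixes a T L :: real
    and d B :: "real \<Rightarrow> real \<Rightarrow> real"
    and \<psi>1 \<psi>2 u0 :: "real \<Rightarrow> real"
    and u :: "real \<Rightarrow> real \<Rightarrow> real"
    and U0 :: "nat \<Rightarrow> nat \<Rightarrow> nat \<Rightarrow> real"
  assumes "a > 0" and "T > 0"
    and d_nonneg: "\<And>x s. x \<in> {0..a} \<Longrightarrow> d x s \<ge> 0"
    and B_nonneg: "\<And>x s. x \<in> {0..a} \<Longrightarrow> B x s \<ge> 0"
    and d_smooth: "Ck_on 1 ({0..a} \<times> UNIV) (\<lambda>(x, s). d x s)"
    and B_smooth: "Ck_on 1 ({0..a} \<times> UNIV) (\<lambda>(x, s). B x s)"
    and \<psi>1_smooth: "Ck_on 1 {0..a} \<psi>1"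
    and \<psi>2_smooth: "Ck_on 1 {0..a} \<psi>2"
    and u_solution: "solves_P a d B \<psi>1 \<psi>2 u0 u"
    and u_smooth: "Ck_bdd_on 3 ({0<..<a} \<times> {0<..<T}) (\<lambda>(x, t). u x t)"
    and "L > 0"
    and d_Lipschitz: "\<And>x s s'. x \<in> {0..a} \<Longrightarrow> s > 0 \<Longrightarrow> s' > 0 \<Longrightarrow> \<bar>d x s - d x s'\<bar> \<le> L * \<bar>s - s'\<bar>"
    and B_Lipschitz: "\<And>x s s'. x \<in> {0..a} \<Longrightarrow> s > 0 \<Longrightarrow> s' > 0 \<Longrightarrow> \<bar>B x s - B x s'\<bar> \<le> L * \<bar>s - s'\<bar>"
  shows "\<exists>R1 R2 :: nat \<times> nat \<Rightarrow> real.
    R1 \<in> O[refinement](\<lambda>(M', N). (space_step a M')\<^sup>2) \<and>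
    R2 \<in> O[refinement](\<lambda>(M', N). (time_step T N)\<^sup>2) \<and>
    (\<forall>M' N. N \<ge> 1 \<longrightarrow>
      (let h = space_step a M'; k = time_step T N; uh = nodal h k u in
        Y_norm h k M' N (Phi h k M' d B \<psi>1 \<psi>2 (U0 M' N) uh) =
        sqrt ((space_norm h M' (\<lambda>i. U0 M' N i - uh 0 i))\<^sup>2 + R1 (M', N) + R2 (M', N))))"
proof -
  obtain K ux uxx uxxx ut utt where "smooth_profile a T K u ux uxx uxxx ut utt"
    and pde: "\<And>x t. x \<in> {0<..<a} \<Longrightarrow> t \<in> {0<..<T} \<Longrightarrow>
        ut x t + ux x t + d x (weighted_population a \<psi>1 u t) * u x t = uxx x t"
    using solution_smooth_profile[OF assms(1,2) u_solution u_smooth] by metis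
  then interpret smooth_profile a T K u ux uxx uxxx ut utt by simp
  have box: "\<exists>C. C-lipschitz_on ({0..a} \<times> {- S..S}) F" if "Ck_on 1 ({0..a} \<times> UNIV) F"
    for S :: real and F :: "real \<times> real \<Rightarrow> real"
    by (rule Ck_on_1_lipschitz_on_compact[OF that, of "{0..a} \<times> {- S..S}"])
       (auto intro: compact_Times convex_Times)
  have weight: "\<exists>C P. C-lipschitz_on {0..a} \<psi> \<and> 0 \<le> P \<and> (\<forall>x\<in>{0..a}. \<bar>\<psi> x\<bar> \<le> P)"
    if \<psi>: "Ck_on 1 {0..a} \<psi>" for \<psi>
  proof -
    obtain C where C: "C-lipschitz_on {0..a} \<psi>"
      by (rule Ck_on_1_lipschitz_on_compact[OF \<psi>, of "{0..a}"]) auto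
    moreover obtain P where "0 \<le> P" "\<And>x. x \<in> {0..a} \<Longrightarrow> \<bar>\<psi> x\<bar> \<le> P"
      using lipschitz_on_compact_bounded[OF C] by auto
    ultimately show ?thesis by blast
  qed
  obtain C1 P1 where \<psi>1: "C1-lipschitz_on {0..a} \<psi>1" "\<And>x. x \<in> {0..a} \<Longrightarrow> \<bar>\<psi>1 x\<bar> \<le> P1" "0 \<le> P1"
    using weight[OF \<psi>1_smooth] by blast
  obtain C2 P2 where \<psi>2: "C2-lipschitz_on {0..a} \<psi>2" "\<And>x. x \<in> {0..a} \<Longrightarrow> \<bar>\<psi>2 x\<bar> \<le> P2" "0 \<le> P2"
    using weight[OF \<psi>2_smooth] by blast
  have bc: "\<exists>D. ((\<lambda>y. u y t) has_real_derivative D) (at 0 within {0..a}) \<and>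
        u 0 t - D = integral {0..a} (\<lambda>x. B x (weighted_population a \<psi>2 u t) * u x t)"
    if "t \<in> {0..T}" for t
  proof -
    have "0 \<le> t" using that by simp
    then show ?thesis using u_solution unfolding solves_P_def by blast
  qed
  have u_a: "u a t = 0" if "0 \<le> t" for t using u_solution that unfolding solves_P_def by blast
  obtain CB where LB:
    "CB-lipschitz_on ({0..a} \<times> {- (3 * a * (P2 * K))..3 * a * (P2 * K)}) (\<lambda>(x, s). B x s)"
    using box[OF B_smooth] by blast
  obtain Rb where Rb: "\<And>M' t. 1 \<le> M' \<Longrightarrow> t \<in> {0..T} \<Longrightarrow> let h = space_step a M' in
    \<bar>(1 + 1 / h) * u 0 t - 1 / h * u h t
      - quad h M' (\<lambda>j. B (real j * h) (discrete_population M' \<psi>2 t) * u (real j * h) t)\<bar> \<le> Rb * h"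
    using boundary_residual[OF \<psi>2 LB bc] by blast
  obtain Cd where Ld:
    "Cd-lipschitz_on ({0..a} \<times> {- (3 * a * (P1 * K))..3 * a * (P1 * K)}) (\<lambda>(x, s). d x s)"
    using box[OF d_smooth] by blast
  obtain Ri where Ri: "\<And>M' i s t. 1 \<le> M' \<Longrightarrow> i \<in> {1..<space_pts M'} \<Longrightarrow> 0 \<le> s \<Longrightarrow> s < t \<Longrightarrow> t \<le> T \<Longrightarrow>
    (let h = space_step a M'; x = real i * h in
    \<bar>(u x t - u x s) / (t - s) + (u x s - u (x - h) s) / h
      + d x (discrete_population M' \<psi>1 s) * u x s
      - (u (x + h) s + u (x - h) s - 2 * u x s) / h\<^sup>2\<bar> \<le> Ri * (h + (t - s)))"
    using interior_residual[OF \<psi>1 Ld pde] by blast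
  define residual where "residual M' N = (let h = space_step a M'; k = time_step T N in
    Phi h k M' d B \<psi>1 \<psi>2 (U0 M' N) (nodal h k u))" for M' N
  \<comment> \<open>Only the initial block is left out; it is retained exactly as the norm of
    \<open>U0 - u\<close>, so the initial vector can be arbitrary.\<close>
  define E where "E = (\<lambda>(M', N). let h = space_step a M'; k = time_step T N; P = residual M' N in
    (time_norm k N (\<lambda>n. P n 0))\<^sup>2 + h * (time_norm k N (\<lambda>n. P n (space_pts M')))\<^sup>2
      + (\<Sum>n=1..N. k * (space_norm h M' (P n))\<^sup>2))"
  have E_bound: "\<bar>E (M', N)\<bar> \<le> (2 * T * Rb\<^sup>2 + 2 * T * a * Ri\<^sup>2) * ((space_step a M')\<^sup>2 + (time_step T N)\<^sup>2)"
    if M': "1 \<le> M'" and N: "1 \<le> N" for M' N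
  proof -
    define h where "h = space_step a M'"
    define k where "k = time_step T N"
    define P where "P = residual M' N"
    have h: "0 < h" using space_step_pos[OF a_pos] by (simp add: h_def)
    have k: "0 < k" "real N * k = T" using T_pos N by (simp_all add: k_def time_step_def)
    have tn: "real n * k \<in> {0..T}" if "n \<le> N" for n
      using that k by (auto simp flip: k(2) intro: mult_right_mono)
    define X where "X = (time_norm k N (\<lambda>n. P n 0))\<^sup>2"
    define Y where "Y = (\<Sum>n=1..N. k * (space_norm h M' (P n))\<^sup>2)"
    have "X \<le> 2 * T * (Rb * h)\<^sup>2"
      unfolding X_def k_def
    proof (rule time_norm_square_le[OF T_pos N])
      fix n assume "n \<le> N"
      from Rb[OF M' tn[OF this]] show "\<bar>P n 0\<bar> \<le> Rb * h"
        by (simp add: P_def residual_def Phi_def nodal_def Let_def discrete_population_def h_def k_def)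
    qed
    also have "\<dots> = 2 * T * Rb\<^sup>2 * h\<^sup>2" by (simp add: power_mult_distrib)
    also have "\<dots> \<le> 2 * T * Rb\<^sup>2 * (h\<^sup>2 + k\<^sup>2)" using T_pos by (intro mult_left_mono) auto
    finally have X: "X \<le> 2 * T * Rb\<^sup>2 * (h\<^sup>2 + k\<^sup>2)" .
    \<comment> \<open>The last block vanishes identically because \<open>u a t = 0\<close>, so its
      division by \<open>h\<close> costs nothing.\<close>
    have "(time_norm k N (\<lambda>n. P n (space_pts M')))\<^sup>2 \<le> 2 * T * 0\<^sup>2"
      unfolding k_def
    proof (rule time_norm_square_le[OF T_pos N])
      fix n assume "n \<le> N"
      then show "\<bar>P n (space_pts M')\<bar> \<le> 0"
        using u_a tn[of n]
        by (simp add: P_def residual_def Phi_def nodal_def Let_def space_pts_mult_space_step k_def)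
           (simp add: space_pts_def)
    qed
    then have W: "h * (time_norm k N (\<lambda>n. P n (space_pts M')))\<^sup>2 = 0" by simp
    have "Y \<le> (\<Sum>n=1..N. k * (a * (Ri * (h + k))\<^sup>2))"
      unfolding Y_def
    proof (rule sum_mono, rule mult_left_mono)
      fix n assume n: "n \<in> {1..N}"
      show "(space_norm h M' (P n))\<^sup>2 \<le> a * (Ri * (h + k))\<^sup>2"
        unfolding h_def
      proof (rule space_norm_square_le[OF a_pos])
        fix i assume i: "i \<in> {1..<space_pts M'}"
        have s: "0 \<le> real (n - 1) * k" "real (n - 1) * k < real n * k" "real n * k \<le> T"
          using tn[of n] n k(1) by auto
        have eqs: "real n * k - real (n - 1) * k = k" "real (i - 1) * h = real i * h - h"
          "real (i + 1) * h = real i * h + h"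
          using n i by (simp_all add: of_nat_diff algebra_simps)
        have "P n i = (u (real i * h) (real n * k) - u (real i * h) (real (n - 1) * k)) / k
          + (u (real i * h) (real (n - 1) * k) - u (real i * h - h) (real (n - 1) * k)) / h
          + d (real i * h) (discrete_population M' \<psi>1 (real (n - 1) * k)) * u (real i * h) (real (n - 1) * k)
          - (u (real i * h + h) (real (n - 1) * k) + u (real i * h - h) (real (n - 1) * k)
              - 2 * u (real i * h) (real (n - 1) * k)) / h\<^sup>2"
          unfolding P_def residual_def Phi_def nodal_def Let_def discrete_population_def
            h_def[symmetric] k_def[symmetric] eqs
          using n i by simp
        then show "\<bar>P n i\<bar> \<le> Ri * (space_step a M' + k)"
          using Ri[OF M' i s] unfolding Let_def h_def[symmetric] eqs by simp
      qed
    qed (use k in simp)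
    also have "\<dots> = T * a * Ri\<^sup>2 * (h + k)\<^sup>2"
      by (simp add: k(2)[symmetric] power_mult_distrib)
    also have "(h + k)\<^sup>2 \<le> 2 * (h\<^sup>2 + k\<^sup>2)"
      using zero_le_power2[of "h - k"] by (simp add: power2_diff power2_sum)
    then have "T * a * Ri\<^sup>2 * (h + k)\<^sup>2 \<le> T * a * Ri\<^sup>2 * (2 * (h\<^sup>2 + k\<^sup>2))"
      using a_pos T_pos by (intro mult_left_mono) auto
    finally have Y: "Y \<le> 2 * T * a * Ri\<^sup>2 * (h\<^sup>2 + k\<^sup>2)" by (simp only: mult_ac)
    have "E (M', N) = X + Y"
      using W unfolding E_def Let_def prod.case h_def[symmetric] k_def[symmetric] P_def[symmetric]
        X_def Y_def by simp
    moreover have "0 \<le> X" "0 \<le> Y" using k by (simp_all add: X_def Y_def sum_nonneg)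
    ultimately show ?thesis
      using X Y unfolding h_def[symmetric] k_def[symmetric] distrib_right by simp
  qed
  obtain R1 R2 where R: "R1 \<in> O[refinement](\<lambda>(M', N). (space_step a M')\<^sup>2)"
    "R2 \<in> O[refinement](\<lambda>(M', N). (time_step T N)\<^sup>2)" "\<And>p. R1 p + R2 p = E p"
    by (rule split_error_by_step_sizes[OF a_pos E_bound]) (assumption | rule that)+
  have "Y_norm h k M' N (Phi h k M' d B \<psi>1 \<psi>2 (U0 M' N) (nodal h k u)) =
      sqrt ((space_norm h M' (\<lambda>i. U0 M' N i - nodal h k u 0 i))\<^sup>2 + R1 (M', N) + R2 (M', N))"
    if "h = space_step a M'" "k = time_step T N" for M' N h k
  proof -
    have Phi: "Phi h k M' d B \<psi>1 \<psi>2 (U0 M' N) (nodal h k u) = residual M' N"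
      by (simp only: residual_def that Let_def)
    \<comment> \<open>\<open>Phi\<close> produces \<open>u - U0\<close>, the claim has
      \<open>U0 - u\<close>; the norm does not see the sign.\<close>
    have initial: "space_norm h M' (residual M' N 0) = space_norm h M' (\<lambda>i. U0 M' N i - nodal h k u 0 i)"
      unfolding space_norm_def Phi[symmetric]
      by (intro arg_cong[where f = sqrt] sum.cong refl)
         (auto simp: Phi_def Let_def abs_minus_commute space_pts_def)
    have E: "R1 (M', N) + R2 (M', N) = (time_norm k N (\<lambda>n. residual M' N n 0))\<^sup>2
        + h * (time_norm k N (\<lambda>n. residual M' N n (space_pts M')))\<^sup>2
        + (\<Sum>n=1..N. k * (space_norm h M' (residual M' N n))\<^sup>2)"
      unfolding R(3) E_def by (simp only: prod.case Let_def that)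
    show ?thesis
      unfolding Phi Y_norm_def initial add.assoc[of _ "R1 _"] E by (simp only: add_ac)
  qed
  with R(1,2) show ?thesis unfolding Let_def by blast
qed

end
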